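(* Let $S$ be a finite alphabet with $|S| \geq 2$. Then $\mathrm{sub}_g(\mathrm{Aut}(S^{\mathbb{Z}}))$ is closed under free products; that is, if $G$ and $H$ are groups with $G \leq \mathrm{Aut}(S^{\mathbb{Z}})$ and $H \leq \mathrm{Aut}(S^{\mathbb{Z}})$, then $G * H \leq \mathrm{Aut}(S^{\mathbb{Z}})$.
   Context: For a finite alphabet $S$, $S^{\mathbb{Z}}$ (the full shift) carries the product topology of discrete topologies, and the shift $\sigma : S^{\mathbb{Z}} \to S^{\mathbb{Z}}$ is $\sigma(x)_i = x_{i+1}$. A cellular automaton on $S^{\mathbb{Z}}$ is a continuous map $f : S^{\mathbb{Z}} \to S^{\mathbb{Z}}$ commuting with $\sigma$. $\mathrm{Aut}(S^{\mathbb{Z}})$ is the group, under composition, of all cellular automata on $S^{\mathbb{Z}}$ having an inverse that is a cellular automaton (equivalently, all bijective cellular automata). For groups $G, K$, write $G \leq K$ if there is an injective group homomorphism $G \to K$. $\mathrm{sub}_g(K)$ denotes the class of isomorphism classes of subgroups of $K$. $G * H$ denotes the free product. *)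

theory Defs
  imports "HOL-Algebra.Group" "HOL-Analysis.Function_Topology"
begin

section \<open>Automorphisms of the full shift\<close>

definition full_shift :: "'s set \<Rightarrow> (int \<Rightarrow> 's) topology" where
  "full_shift S = product_topology (\<lambda>_. discrete_topology S) UNIV"

definition shift :: "(int \<Rightarrow> 's) \<Rightarrow> int \<Rightarrow> 's" where
  "shift x = (\<lambda>i. x (i + 1))"

definition cellular_automaton :: "'s set \<Rightarrow> ((int \<Rightarrow> 's) \<Rightarrow> (int \<Rightarrow> 's)) \<Rightarrow> bool" where
  "cellular_automaton S f \<longleftrightarrow>
     continuous_map (full_shift S) (full_shift S) f \<and>
     (\<forall>x \<in> topspace (full_shift S). f (shift x) = shift (f x))"

text \<open>Group elements are maps on the set of configurations only; as in \<open>BijGroup\<close>, they are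
  represented by extensional functions, so that equality is equality of maps on that set.\<close>

definition Aut_shift :: "'s set \<Rightarrow> ((int \<Rightarrow> 's) \<Rightarrow> (int \<Rightarrow> 's)) monoid" where
  "Aut_shift S =
     \<lparr>carrier = {f \<in> extensional (topspace (full_shift S)). cellular_automaton S f \<and>
        (\<exists>g. cellular_automaton S g \<and>
             (\<forall>x \<in> topspace (full_shift S). g (f x) = x \<and> f (g x) = x))},
      mult = compose (topspace (full_shift S)),
      one = (\<lambda>x \<in> topspace (full_shift S). x)\<rparr>"

lemma topspace_full_shift: "topspace (full_shift S) = {x. \<forall>i. x i \<in> S}"
  by (auto simp: full_shift_def)

lemma shift_in_full_shift:
  "x \<in> topspace (full_shift S) \<Longrightarrow> shift x \<in> topspace (full_shift S)"
  by (auto simp: topspace_full_shift shift_def)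

lemma cellular_automaton_in_full_shift:
  "\<lbrakk>cellular_automaton S f; x \<in> topspace (full_shift S)\<rbrakk> \<Longrightarrow> f x \<in> topspace (full_shift S)"
  unfolding cellular_automaton_def continuous_map_def by blast

lemma cellular_automaton_cong:
  assumes "cellular_automaton S f" "\<And>x. x \<in> topspace (full_shift S) \<Longrightarrow> f x = g x"
  shows "cellular_automaton S g"
  using assms shift_in_full_shift[of _ S] continuous_map_eq[of "full_shift S" "full_shift S" f g]
  unfolding cellular_automaton_def by simp

lemma cellular_automaton_compose:
  assumes "cellular_automaton S f" "cellular_automaton S g"
  shows "cellular_automaton S (compose (topspace (full_shift S)) f g)"
proof (rule cellular_automaton_cong)
  show "cellular_automaton S (f \<circ> g)"
    using assms cellular_automaton_in_full_shift[OF assms(2)]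
    by (simp add: cellular_automaton_def continuous_map_compose[of _ "full_shift S"])
qed (simp add: compose_eq)

lemma cellular_automaton_id: "cellular_automaton S (\<lambda>x \<in> topspace (full_shift S). x)"
  by (rule cellular_automaton_cong[where f = "\<lambda>x. x"]) (auto simp: cellular_automaton_def)

lemma group_Aut_shift: "group (Aut_shift S)"
proof (rule groupI)
  let ?X = "topspace (full_shift S)"
  note in_X = cellular_automaton_in_full_shift
  fix f assume "f \<in> carrier (Aut_shift S)"
  then obtain g where f: "f \<in> extensional ?X" "cellular_automaton S f"
    and g: "cellular_automaton S g" "\<And>x. x \<in> ?X \<Longrightarrow> g (f x) = x \<and> f (g x) = x"
    by (auto simp: Aut_shift_def)
  show "\<one>\<^bsub>Aut_shift S\<^esub> \<otimes>\<^bsub>Aut_shift S\<^esub> f = f"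
    using f in_X[OF f(2)] by (auto simp: Aut_shift_def compose_def extensional_def)
  have g': "cellular_automaton S (restrict g ?X)"
    using g(1) by (rule cellular_automaton_cong) simp
  have "restrict g ?X \<in> carrier (Aut_shift S)"
    using f g g' in_X[OF f(2)] by (auto simp: Aut_shift_def intro!: exI[of _ f])
  moreover have "restrict g ?X \<otimes>\<^bsub>Aut_shift S\<^esub> f = \<one>\<^bsub>Aut_shift S\<^esub>"
    using g in_X[OF f(2)] by (auto simp: Aut_shift_def compose_def)
  ultimately show "\<exists>h \<in> carrier (Aut_shift S). h \<otimes>\<^bsub>Aut_shift S\<^esub> f = \<one>\<^bsub>Aut_shift S\<^esub>"
    by blast
next
  let ?X = "topspace (full_shift S)"
  note in_X = cellular_automaton_in_full_shift
  fix f f' assume "f \<in> carrier (Aut_shift S)" "f' \<in> carrier (Aut_shift S)"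
  then obtain g g' where f: "cellular_automaton S f" "cellular_automaton S f'"
    and g: "cellular_automaton S g" "\<And>x. x \<in> ?X \<Longrightarrow> g (f x) = x \<and> f (g x) = x"
    and g': "cellular_automaton S g'" "\<And>x. x \<in> ?X \<Longrightarrow> g' (f' x) = x \<and> f' (g' x) = x"
    by (auto simp: Aut_shift_def)
  have "\<forall>x \<in> ?X. compose ?X g' g (compose ?X f f' x) = x \<and>
                compose ?X f f' (compose ?X g' g x) = x"
    using g(2) g'(2) in_X[OF f(1)] in_X[OF f(2)] in_X[OF g(1)] in_X[OF g'(1)]
    by (simp add: compose_def)
  then show "f \<otimes>\<^bsub>Aut_shift S\<^esub> f' \<in> carrier (Aut_shift S)"
    using cellular_automaton_compose[OF f] cellular_automaton_compose[OF g'(1) g(1)]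
    by (auto simp: Aut_shift_def intro!: exI[of _ "compose ?X g' g"])
next
  fix f f' f'' assume "f'' \<in> carrier (Aut_shift S)"
  then show "f \<otimes>\<^bsub>Aut_shift S\<^esub> f' \<otimes>\<^bsub>Aut_shift S\<^esub> f'' = f \<otimes>\<^bsub>Aut_shift S\<^esub> (f' \<otimes>\<^bsub>Aut_shift S\<^esub> f'')"
    by (auto simp: Aut_shift_def compose_def cellular_automaton_in_full_shift)
next
  show "\<one>\<^bsub>Aut_shift S\<^esub> \<in> carrier (Aut_shift S)"
    using cellular_automaton_id[of S]
    by (auto simp: Aut_shift_def intro!: exI[of _ "\<lambda>x \<in> topspace (full_shift S). x"])
qed


section \<open>Embeddings and free products of groups\<close>

definition embeds :: "('a, 'x) monoid_scheme \<Rightarrow> ('b, 'y) monoid_scheme \<Rightarrow> bool" where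
  "embeds G K \<longleftrightarrow> (\<exists>h \<in> hom G K. inj_on h (carrier G))"

text \<open>Elements of the free product are reduced words: lists of nontrivial elements, alternating
  between the two factors. The function \<open>fp_cons\<close> multiplies a reduced word on the left by one
  nontrivial letter and reduces the result. That this is the free product is confirmed by the
  universal property \<open>free_product_universal\<close> below.\<close>

fun fp_cons :: "('a, 'x) monoid_scheme \<Rightarrow> ('b, 'y) monoid_scheme \<Rightarrow>
    'a + 'b \<Rightarrow> ('a + 'b) list \<Rightarrow> ('a + 'b) list" where
  "fp_cons G H (Inl a) (Inl b # w) =
     (if a \<otimes>\<^bsub>G\<^esub> b = \<one>\<^bsub>G\<^esub> then w else Inl (a \<otimes>\<^bsub>G\<^esub> b) # w)"
| "fp_cons G H (Inr a) (Inr b # w) =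
     (if a \<otimes>\<^bsub>H\<^esub> b = \<one>\<^bsub>H\<^esub> then w else Inr (a \<otimes>\<^bsub>H\<^esub> b) # w)"
| "fp_cons G H s w = s # w"

definition free_product :: "('a, 'x) monoid_scheme \<Rightarrow> ('b, 'y) monoid_scheme \<Rightarrow>
    ('a + 'b) list monoid" where
  "free_product G H =
     \<lparr>carrier = {w. set w \<subseteq> (carrier G - {\<one>\<^bsub>G\<^esub>}) <+> (carrier H - {\<one>\<^bsub>H\<^esub>}) \<and>
                    successively (\<lambda>s t. isl s \<noteq> isl t) w},
      mult = (\<lambda>u v. foldr (fp_cons G H) u v),
      one = []\<rparr>"

definition fp_inl :: "('a, 'x) monoid_scheme \<Rightarrow> 'a \<Rightarrow> ('a + 'b) list" where
  "fp_inl G a = (if a = \<one>\<^bsub>G\<^esub> then [] else [Inl a])"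

definition fp_inr :: "('b, 'y) monoid_scheme \<Rightarrow> 'b \<Rightarrow> ('a + 'b) list" where
  "fp_inr H b = (if b = \<one>\<^bsub>H\<^esub> then [] else [Inr b])"

lemma free_product_simps [simp]:
  "x \<otimes>\<^bsub>free_product G H\<^esub> y = foldr (fp_cons G H) x y"
  "\<one>\<^bsub>free_product G H\<^esub> = []"
  "[] \<in> carrier (free_product G H)"
  by (auto simp: free_product_def)

lemma free_product_Cons:
  "s # w \<in> carrier (free_product G H) \<longleftrightarrow>
     s \<in> (carrier G - {\<one>\<^bsub>G\<^esub>}) <+> (carrier H - {\<one>\<^bsub>H\<^esub>}) \<and> w \<in> carrier (free_product G H) \<and>
     (w = [] \<or> isl s \<noteq> isl (hd w))"
  by (auto simp: free_product_def successively_Cons)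

locale two_groups = G: group G + H: group H
  for G :: "('a, 'x) monoid_scheme" and H :: "('b, 'y) monoid_scheme"
begin

abbreviation "P \<equiv> free_product G H"
abbreviation "letters \<equiv> (carrier G - {\<one>\<^bsub>G\<^esub>}) <+> (carrier H - {\<one>\<^bsub>H\<^esub>})"

lemma fp_cons_closed: "\<lbrakk>s \<in> letters; w \<in> carrier P\<rbrakk> \<Longrightarrow> fp_cons G H s w \<in> carrier P"
  by (cases "(G, H, s, w)" rule: fp_cons.cases) (auto simp: free_product_Cons)

lemma fp_mult_closed: "\<lbrakk>u \<in> carrier P; v \<in> carrier P\<rbrakk> \<Longrightarrow> foldr (fp_cons G H) u v \<in> carrier P"
  by (induction u) (auto simp: free_product_Cons fp_cons_closed simp del: fp_cons.simps)

lemma fp_cons_reduced: "s # w \<in> carrier P \<Longrightarrow> fp_cons G H s w = s # w"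
  by (cases s; cases w; cases "hd w") (auto simp: free_product_Cons)

lemma fp_cons_Inl_Inl:
  assumes "a \<in> carrier G - {\<one>\<^bsub>G\<^esub>}" "b \<in> carrier G - {\<one>\<^bsub>G\<^esub>}" "w \<in> carrier P"
  shows "fp_cons G H (Inl a) (fp_cons G H (Inl b) w) =
    (if a \<otimes>\<^bsub>G\<^esub> b = \<one>\<^bsub>G\<^esub> then w else fp_cons G H (Inl (a \<otimes>\<^bsub>G\<^esub> b)) w)"
proof (cases "\<exists>c v. w = Inl c # v")
  case True
  then obtain c v where w: "w = Inl c # v" by blast
  then have c: "c \<in> carrier G" "c \<noteq> \<one>\<^bsub>G\<^esub>" and v: "v = [] \<or> (\<exists>d u. v = Inr d # u)"
    using assms by (auto simp: free_product_Cons neq_Nil_conv isl_def)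
  have cv: "fp_cons G H (Inl x) v = Inl x # v" for x using v by auto
  have 1: "a \<otimes>\<^bsub>G\<^esub> (b \<otimes>\<^bsub>G\<^esub> c) = a \<otimes>\<^bsub>G\<^esub> b \<otimes>\<^bsub>G\<^esub> c" using assms c by (simp add: G.m_assoc)
  have 2: "a \<otimes>\<^bsub>G\<^esub> b \<otimes>\<^bsub>G\<^esub> c = a" if "b \<otimes>\<^bsub>G\<^esub> c = \<one>\<^bsub>G\<^esub>" using that assms by (simp flip: 1)
  have 3: "a = c" if "a \<otimes>\<^bsub>G\<^esub> b = \<one>\<^bsub>G\<^esub>" "b \<otimes>\<^bsub>G\<^esub> c = \<one>\<^bsub>G\<^esub>"
    using 2[OF that(2)] that(1) c by simp
  show ?thesis
    using assms c unfolding w by (auto simp: cv 1 2 3)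
next
  case False
  then have "w = [] \<or> (\<exists>d u. w = Inr d # u)" by (metis list.exhaust sum.exhaust)
  then show ?thesis by auto
qed

lemma fp_cons_Inr_Inr:
  assumes "a \<in> carrier H - {\<one>\<^bsub>H\<^esub>}" "b \<in> carrier H - {\<one>\<^bsub>H\<^esub>}" "w \<in> carrier P"
  shows "fp_cons G H (Inr a) (fp_cons G H (Inr b) w) =
    (if a \<otimes>\<^bsub>H\<^esub> b = \<one>\<^bsub>H\<^esub> then w else fp_cons G H (Inr (a \<otimes>\<^bsub>H\<^esub> b)) w)"
proof (cases "\<exists>c v. w = Inr c # v")
  case True
  then obtain c v where w: "w = Inr c # v" by blast
  then have c: "c \<in> carrier H" "c \<noteq> \<one>\<^bsub>H\<^esub>" and v: "v = [] \<or> (\<exists>d u. v = Inl d # u)"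
    using assms by (auto simp: free_product_Cons neq_Nil_conv isl_def)
  have cv: "fp_cons G H (Inr x) v = Inr x # v" for x using v by auto
  have 1: "a \<otimes>\<^bsub>H\<^esub> (b \<otimes>\<^bsub>H\<^esub> c) = a \<otimes>\<^bsub>H\<^esub> b \<otimes>\<^bsub>H\<^esub> c" using assms c by (simp add: H.m_assoc)
  have 2: "a \<otimes>\<^bsub>H\<^esub> b \<otimes>\<^bsub>H\<^esub> c = a" if "b \<otimes>\<^bsub>H\<^esub> c = \<one>\<^bsub>H\<^esub>" using that assms by (simp flip: 1)
  have 3: "a = c" if "a \<otimes>\<^bsub>H\<^esub> b = \<one>\<^bsub>H\<^esub>" "b \<otimes>\<^bsub>H\<^esub> c = \<one>\<^bsub>H\<^esub>"
    using 2[OF that(2)] that(1) c by simp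
  show ?thesis
    using assms c unfolding w by (auto simp: cv 1 2 3)
next
  case False
  then have "w = [] \<or> (\<exists>d u. w = Inl d # u)" by (metis list.exhaust sum.exhaust)
  then show ?thesis by auto
qed

lemma fp_cons_foldr:
  assumes "s \<in> letters" "x \<in> carrier P" "w \<in> carrier P"
  shows "foldr (fp_cons G H) (fp_cons G H s x) w = fp_cons G H s (foldr (fp_cons G H) x w)"
proof (cases "(G, H, s, x)" rule: fp_cons.cases)
  case (1 G' H' a b v)
  then have "foldr (fp_cons G H) v w \<in> carrier P"
    using assms by (intro fp_mult_closed) (auto simp: free_product_Cons)
  then show ?thesis using 1 assms fp_cons_Inl_Inl[of a b]
    by (auto simp: free_product_Cons)
next
  case (2 G' H' a b v)
  then have "foldr (fp_cons G H) v w \<in> carrier P"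
    using assms by (intro fp_mult_closed) (auto simp: free_product_Cons)
  then show ?thesis using 2 assms fp_cons_Inr_Inr[of a b]
    by (auto simp: free_product_Cons)
qed auto

lemma fp_assoc:
  assumes "u \<in> carrier P" "v \<in> carrier P" "w \<in> carrier P"
  shows "foldr (fp_cons G H) (foldr (fp_cons G H) u v) w =
         foldr (fp_cons G H) u (foldr (fp_cons G H) v w)"
  using assms(1)
  by (induction u) (auto simp: free_product_Cons fp_cons_foldr fp_mult_closed assms simp del: fp_cons.simps)

lemma fp_letter_inverse:
  assumes "s \<in> letters"
  obtains t where "t \<in> letters" "fp_cons G H t [s] = []"
proof (cases s)
  case (Inl a)
  then have "Inl (inv\<^bsub>G\<^esub> a) \<in> letters" using assms by auto
  moreover have "fp_cons G H (Inl (inv\<^bsub>G\<^esub> a)) [s] = []" using assms Inl by auto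
  ultimately show ?thesis by (rule that)
next
  case (Inr a)
  then have "Inr (inv\<^bsub>H\<^esub> a) \<in> letters" using assms by auto
  moreover have "fp_cons G H (Inr (inv\<^bsub>H\<^esub> a)) [s] = []" using assms Inr by auto
  ultimately show ?thesis by (rule that)
qed

lemma fp_left_inverse: "w \<in> carrier P \<Longrightarrow> \<exists>y \<in> carrier P. foldr (fp_cons G H) y w = []"
proof (induction w)
  case Nil
  show ?case by (rule bexI[of _ "[]"]) auto
next
  case (Cons s w)
  then obtain y where y: "y \<in> carrier P" "foldr (fp_cons G H) y w = []"
    by (auto simp: free_product_Cons)
  have s: "s \<in> letters" and w: "w \<in> carrier P" using Cons.prems by (auto simp: free_product_Cons)
  obtain t where t: "t \<in> letters" "fp_cons G H t [s] = []" using fp_letter_inverse[OF s] .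
  have t1: "[t] \<in> carrier P" and s1: "[s] \<in> carrier P" using t s by (auto simp: free_product_Cons)
  have "foldr (fp_cons G H) [t] (s # w) = foldr (fp_cons G H) [t] (foldr (fp_cons G H) [s] w)"
    using fp_cons_reduced[OF Cons.prems] by simp
  also have "\<dots> = w" using fp_assoc[OF t1 s1 w] t by simp
  finally have "foldr (fp_cons G H) (foldr (fp_cons G H) y [t]) (s # w) = []"
    using fp_assoc[OF y(1) t1 Cons.prems] y by simp
  then show ?case using fp_mult_closed[OF y(1) t1] by blast
qed

lemma group_free_product: "group P"
  by (rule groupI) (simp_all add: fp_mult_closed fp_assoc fp_left_inverse)

lemma fp_inl_hom: "fp_inl G \<in> hom G P"
  by (rule homI) (auto simp: fp_inl_def free_product_Cons)

lemma fp_inr_hom: "fp_inr H \<in> hom H P"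
  by (rule homI) (auto simp: fp_inr_def free_product_Cons)

theorem free_product_universal:
  fixes K :: "('c, 'z) monoid_scheme"
  assumes "group K" and \<phi>: "\<phi> \<in> hom G K" and \<psi>: "\<psi> \<in> hom H K"
  shows "\<exists>f \<in> hom P K. (\<forall>a \<in> carrier G. f (fp_inl G a) = \<phi> a) \<and> (\<forall>b \<in> carrier H. f (fp_inr H b) = \<psi> b)"
    and "\<lbrakk>f \<in> hom P K; f' \<in> hom P K;
          \<And>a. a \<in> carrier G \<Longrightarrow> f (fp_inl G a) = f' (fp_inl G a);
          \<And>b. b \<in> carrier H \<Longrightarrow> f (fp_inr H b) = f' (fp_inr H b); w \<in> carrier P\<rbrakk>
         \<Longrightarrow> f w = f' w"
proof -
  interpret K: group K by fact
  interpret P: group P by (rule group_free_product)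
  have one: "\<phi> \<one>\<^bsub>G\<^esub> = \<one>\<^bsub>K\<^esub>" "\<psi> \<one>\<^bsub>H\<^esub> = \<one>\<^bsub>K\<^esub>"
    using hom_one[OF \<phi>] hom_one[OF \<psi>] G.group_axioms H.group_axioms K.group_axioms by auto
  have cl: "case_sum \<phi> \<psi> s \<in> carrier K" if "s \<in> letters" for s
    using that hom_in_carrier[OF \<phi>] hom_in_carrier[OF \<psi>] by auto
  define F where "F w = foldr (\<lambda>s k. case_sum \<phi> \<psi> s \<otimes>\<^bsub>K\<^esub> k) w \<one>\<^bsub>K\<^esub>" for w
  have F_Nil: "F [] = \<one>\<^bsub>K\<^esub>" and F_Cons: "F (s # w) = case_sum \<phi> \<psi> s \<otimes>\<^bsub>K\<^esub> F w" for s w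
    by (auto simp: F_def)
  have F_closed: "F w \<in> carrier K" if "w \<in> carrier P" for w
    using that by (induction w) (auto simp: F_Nil F_Cons free_product_Cons cl simp del: sum.case)
  have F_fp_cons: "F (fp_cons G H s w) = case_sum \<phi> \<psi> s \<otimes>\<^bsub>K\<^esub> F w"
    if s: "s \<in> letters" and w: "w \<in> carrier P" for s w
  proof (cases "(G, H, s, w)" rule: fp_cons.cases)
    case (1 G' H' a b v)
    then have ab: "a \<in> carrier G" "b \<in> carrier G" "F v \<in> carrier K"
      using s w F_closed by (auto simp: free_product_Cons)
    then have "\<phi> a \<otimes>\<^bsub>K\<^esub> (\<phi> b \<otimes>\<^bsub>K\<^esub> F v) = \<phi> (a \<otimes>\<^bsub>G\<^esub> b) \<otimes>\<^bsub>K\<^esub> F v"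
      using \<phi> by (simp add: hom_mult hom_in_carrier K.m_assoc)
    then show ?thesis using 1 ab one by (auto simp: F_Cons)
  next
    case (2 G' H' a b v)
    then have ab: "a \<in> carrier H" "b \<in> carrier H" "F v \<in> carrier K"
      using s w F_closed by (auto simp: free_product_Cons)
    then have "\<psi> a \<otimes>\<^bsub>K\<^esub> (\<psi> b \<otimes>\<^bsub>K\<^esub> F v) = \<psi> (a \<otimes>\<^bsub>H\<^esub> b) \<otimes>\<^bsub>K\<^esub> F v"
      using \<psi> by (simp add: hom_mult hom_in_carrier K.m_assoc)
    then show ?thesis using 2 ab one by (auto simp: F_Cons)
  qed (auto simp: F_Nil F_Cons)
  have "F \<in> hom P K"
  proof (rule homI)
    fix u v assume "u \<in> carrier P" "v \<in> carrier P"
    then show "F (u \<otimes>\<^bsub>P\<^esub> v) = F u \<otimes>\<^bsub>K\<^esub> F v"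
      by (induction u)
         (auto simp: F_Nil F_Cons F_fp_cons free_product_Cons fp_mult_closed F_closed cl K.m_assoc
               simp del: sum.case fp_cons.simps)
  qed (rule F_closed)
  moreover have "\<forall>a \<in> carrier G. F (fp_inl G a) = \<phi> a" "\<forall>b \<in> carrier H. F (fp_inr H b) = \<psi> b"
    using \<phi> \<psi> by (auto simp: fp_inl_def fp_inr_def F_Nil F_Cons one hom_in_carrier)
  ultimately show "\<exists>f \<in> hom P K. (\<forall>a \<in> carrier G. f (fp_inl G a) = \<phi> a) \<and>
      (\<forall>b \<in> carrier H. f (fp_inr H b) = \<psi> b)"
    by blast
  assume f: "f \<in> hom P K" "f' \<in> hom P K"
    and l: "\<And>a. a \<in> carrier G \<Longrightarrow> f (fp_inl G a) = f' (fp_inl G a)"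
    and r: "\<And>b. b \<in> carrier H \<Longrightarrow> f (fp_inr H b) = f' (fp_inr H b)" and "w \<in> carrier P"
  show "f w = f' w" using \<open>w \<in> carrier P\<close>
  proof (induction w)
    case Nil
    show ?case using f[THEN hom_one] P.group_axioms K.group_axioms by simp
  next
    case (Cons s w)
    have s: "s \<in> letters" "[s] \<in> carrier P" "w \<in> carrier P"
      using Cons.prems by (auto simp: free_product_Cons)
    have eq: "f [s] = f' [s]"
    proof (cases s)
      case (Inl a)
      then have "a \<in> carrier G" "a \<noteq> \<one>\<^bsub>G\<^esub>" using s(1) by auto
      then show ?thesis using l[of a] Inl by (simp add: fp_inl_def)
    next
      case (Inr b)
      then have "b \<in> carrier H" "b \<noteq> \<one>\<^bsub>H\<^esub>" using s(1) by auto
      then show ?thesis using r[of b] Inr by (simp add: fp_inr_def)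
    qed
    have w: "s # w = [s] \<otimes>\<^bsub>P\<^esub> w" using fp_cons_reduced[OF Cons.prems] by simp
    show ?case
      by (simp only: w hom_mult[OF f(1) s(2,3)] hom_mult[OF f(2) s(2,3)] eq Cons.IH[OF s(3)])
  qed
qed

end

end

theory Submission
  imports Defs "HOL-Algebra.Coset"
begin

text \<open>
  It suffices to let \<open>K\<close>, the automorphism group of the full shift over \<open>S\<close>, act on configurations
  in two ways \<open>\<alpha>\<^sub>0, \<alpha>\<^sub>1\<close> such that no alternating product of nontrivial elements acts trivially: if
  \<open>\<phi> : G \<rightarrow> K\<close> and \<open>\<psi> : H \<rightarrow> K\<close> are injective, then \<open>\<alpha>\<^sub>1 \<circ> \<phi>\<close> and \<open>\<alpha>\<^sub>0 \<circ> \<psi>\<close> extend to the free product,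
  and the extension has trivial kernel.

  Both actions are \<^emph>\<open>conveyor belts\<close>. Fix \<open>a \<noteq> b\<close> in \<open>S\<close>. A block is a word of length 11 whose fixed
  letters make it impossible for two blocks to overlap. It carries a kind (a bit), a reference symbol
  and two data symbols, called top and bottom. Adjacent live blocks of one kind form a belt: read
  the top symbols from left to right, then the bottom symbols from right to left, cyclically. An
  element \<open>f\<close> of \<open>K\<close> acts on the belts of kind \<open>\<tau>\<close> by applying \<open>f\<close> to the periodic configuration
  spelled by each belt (a run that is infinite to one or both sides spells an ordinary configuration,
  so no case distinction arises). Since \<open>f\<close> commutes with the shift this is a homomorphism for each
  \<open>\<tau>\<close>, and since \<open>f\<close> is continuous it is a cellular automaton: lemma \<open>belt_aut_hom\<close>.

  The two actions interact only through liveness: a block is \<^emph>\<open>not\<close> live if its left neighbour is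
  a block of the other kind whose top symbol equals the reference symbol. So the data of one kind switch
  single blocks of the other kind on and off, and this carries information. Given a nontrivial \<open>f\<close>,
  take the least \<open>n\<close> such that \<open>f\<close> moves some point \<open>u\<close> of period \<open>2n\<close> (lemma
  \<open>moves_at_length_exists\<close>). On a segment of \<open>n\<close> blocks holding \<open>u\<close>, if the first block is dead, then the
  rest is a belt of period \<open>2(n - 1)\<close> and \<open>f\<close> changes nothing; if it is live, then \<open>f\<close>
  changes \<open>u\<close>, visibly at the right end after a rotation of \<open>u\<close>. The symbol at the right end
  in turn decides whether the first block of an adjacent segment of the other kind is live.

  For an alternating product, line up one such segment for each factor. If segment \<open>j\<close> holds its
  \<open>u\<close> at the moment when factor \<open>j\<close> is applied, then changing one symbol to the left of all
  segments changes the right end of the last segment after the whole product has been applied (lemma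
  \<open>relay_transmits\<close>). The identity map would not do this. Earlier factors of the same kind
  do stir the contents of a segment before its turn comes, but all factors are invertible and nothing
  on the right influences what happens on the left, so the required contents can be pulled back to
  the initial configuration, one segment at a time (lemmas \<open>relay_pull_back\<close>, \<open>relay_exists\<close>).
\<close>

section \<open>Cellular automata as locally determined maps\<close>

abbreviation configs :: "'s set \<Rightarrow> (int \<Rightarrow> 's) set" where
  "configs S \<equiv> topspace (full_shift S)"

lemma configs_iff: "x \<in> configs S \<longleftrightarrow> (\<forall>i. x i \<in> S)"
  by (simp add: topspace_full_shift)

text \<open>
  This is continuity into a discrete space, phrased so that it can be checked along the
  structure of a term: also a coordinate whose index depends on the configuration is covered
  by \<open>locally_determined_app\<close> below.
\<close>
definition locally_determined :: "'s set \<Rightarrow> ((int \<Rightarrow> 's) \<Rightarrow> 'b) \<Rightarrow> bool" where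
  "locally_determined S g \<longleftrightarrow> (\<forall>x \<in> configs S. \<exists>K. finite K \<and>
     (\<forall>y \<in> configs S. (\<forall>i \<in> K. y i = x i) \<longrightarrow> g y = g x))"

lemma locally_determinedE:
  assumes "locally_determined S g" "x \<in> configs S"
  obtains K where "finite K" "\<forall>y \<in> configs S. (\<forall>i \<in> K. y i = x i) \<longrightarrow> g y = g x"
  using assms unfolding locally_determined_def by blast

lemma locally_determined_const: "locally_determined S (\<lambda>x. c)"
  by (auto simp: locally_determined_def)

lemma locally_determined_coord: "locally_determined S (\<lambda>x. x i)"
  unfolding locally_determined_def by (intro ballI exI[of _ "{i}"]) auto

text \<open>
  The value \<open>c x\<close> is constant near \<open>x\<close>, so near \<open>x\<close> the map is \<open>\<lambda>y. h y (c x)\<close>, with a fixed index.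
\<close>
lemma locally_determined_app:
  assumes h: "\<And>j. locally_determined S (\<lambda>x. h x j)" and c: "locally_determined S c"
  shows "locally_determined S (\<lambda>x. h x (c x))"
  unfolding locally_determined_def
proof
  fix x assume x: "x \<in> configs S"
  obtain K where K: "finite K" "\<forall>y \<in> configs S. (\<forall>i \<in> K. y i = x i) \<longrightarrow> c y = c x"
    using locally_determinedE[OF c x] .
  obtain L where L: "finite L"
      "\<forall>y \<in> configs S. (\<forall>i \<in> L. y i = x i) \<longrightarrow> h y (c x) = h x (c x)"
    using locally_determinedE[OF h[of "c x"] x] .
  have "h y (c y) = h x (c x)" if "y \<in> configs S" "\<forall>i \<in> K \<union> L. y i = x i" for y
    using bspec[OF K(2) that(1)] bspec[OF L(2) that(1)] that(2) by simp
  then show "\<exists>K. finite K \<and> (\<forall>y \<in> configs S. (\<forall>i \<in> K. y i = x i) \<longrightarrow> h y (c y) = h x (c x))"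
    using K(1) L(1) by (intro exI[of _ "K \<union> L"]) blast
qed

lemma locally_determined_comp:
  "locally_determined S c \<Longrightarrow> locally_determined S (\<lambda>x. g (c x))"
  by (rule locally_determined_app[where h = "\<lambda>x. g"]) (rule locally_determined_const)

lemma locally_determined_comp2:
  assumes "locally_determined S c" "locally_determined S d"
  shows "locally_determined S (\<lambda>x. g (c x) (d x))"
  by (rule locally_determined_app[where h = "\<lambda>x. g (c x)"])
     (use assms locally_determined_comp[of S c "\<lambda>z. g z j" for j] in auto)

lemma locally_determined_if:
  assumes "locally_determined S P" "locally_determined S c" "locally_determined S d"
  shows "locally_determined S (\<lambda>x. if P x then c x else d x)"
proof (rule locally_determined_app[where h = "\<lambda>x q. if q then c x else d x", OF _ assms(1)])
  show "locally_determined S (\<lambda>x. if q then c x else d x)" for q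
    using assms(2,3) by (cases q) simp_all
qed

lemma continuous_map_full_shift_discrete:
  "continuous_map (full_shift S) (discrete_topology S) g \<longleftrightarrow>
     (\<forall>x \<in> configs S. g x \<in> S) \<and> locally_determined S g"
proof (intro iffI conjI)
  assume g: "continuous_map (full_shift S) (discrete_topology S) g"
  show gS: "\<forall>x \<in> configs S. g x \<in> S" using g by (auto simp: continuous_map_def)
  show "locally_determined S g" unfolding locally_determined_def
  proof
    fix x assume x: "x \<in> configs S"
    have op: "openin (full_shift S) {y \<in> configs S. g y \<in> {g x}}"
      using g gS x by (intro openin_continuous_map_preimage) auto
    then obtain U where U: "finite {i. U i \<noteq> topspace (discrete_topology S)}"
        "x \<in> Pi\<^sub>E UNIV U" "Pi\<^sub>E UNIV U \<subseteq> {y \<in> configs S. g y \<in> {g x}}"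
    proof -
      have "x \<in> {y \<in> configs S. g y \<in> {g x}}" using x by simp
      with op have "\<exists>U. finite {i \<in> UNIV. U i \<noteq> topspace (discrete_topology S)} \<and>
          (\<forall>i \<in> UNIV. openin (discrete_topology S) (U i)) \<and> x \<in> Pi\<^sub>E UNIV U \<and>
          Pi\<^sub>E UNIV U \<subseteq> {y \<in> configs S. g y \<in> {g x}}"
        by (subst (asm) full_shift_def, subst (asm) openin_product_topology_alt) (erule bspec)
      then show ?thesis using that by auto
    qed
    show "\<exists>K. finite K \<and> (\<forall>y \<in> configs S. (\<forall>i \<in> K. y i = x i) \<longrightarrow> g y = g x)"
    proof (intro exI conjI ballI impI)
      fix y assume y: "y \<in> configs S"
        "\<forall>i \<in> {i. U i \<noteq> topspace (discrete_topology S)}. y i = x i"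
      have "y i \<in> U i" for i
        using y U(2) by (cases "U i = S") (auto simp: configs_iff PiE_def Pi_def)
      then show "g y = g x" using U(3) by (auto simp: PiE_def Pi_def)
    qed (rule U(1))
  qed
next
  assume g: "(\<forall>x \<in> configs S. g x \<in> S) \<and> locally_determined S g"
  have "openin (full_shift S) {x \<in> configs S. g x \<in> U}" for U
  proof (subst openin_subopen, intro ballI)
    fix x assume "x \<in> {x \<in> configs S. g x \<in> U}"
    then have x: "x \<in> configs S" "g x \<in> U" by auto
    obtain K where K: "finite K" "\<forall>y \<in> configs S. (\<forall>i \<in> K. y i = x i) \<longrightarrow> g y = g x"
      using locally_determinedE[OF conjunct2[OF g] x(1)] .
    let ?V = "\<lambda>i. if i \<in> K then {x i} else S"
    have "{i. ?V i \<noteq> S} \<subseteq> K" by auto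
    then have fin: "finite {i. ?V i \<noteq> S}" using K(1) finite_subset by blast
    have "openin (full_shift S) (Pi\<^sub>E UNIV ?V)"
      unfolding full_shift_def using x fin
      by (intro product_topology_basis) (auto simp: configs_iff)
    moreover have "x \<in> Pi\<^sub>E UNIV ?V" using x by (auto simp: configs_iff)
    moreover have "y \<in> {x \<in> configs S. g x \<in> U}" if "y \<in> Pi\<^sub>E UNIV ?V" for y
    proof -
      have V: "y i \<in> ?V i" for i using that by (auto simp: PiE_def Pi_def)
      then have "y i \<in> S" for i using V[of i] x by (cases "i \<in> K") (auto simp: configs_iff)
      then have y: "y \<in> configs S" by (auto simp: configs_iff)
      have "\<forall>i \<in> K. y i = x i" using V by (metis singletonD)
      then have "g y = g x" using bspec[OF K(2) y] by simp
      then show ?thesis using x(2) y by simp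
    qed
    ultimately show "\<exists>T. openin (full_shift S) T \<and> x \<in> T \<and> T \<subseteq> {x \<in> configs S. g x \<in> U}" by blast
  qed
  then show "continuous_map (full_shift S) (discrete_topology S) g"
    using g by (auto simp: continuous_map_def)
qed

lemma cellular_automaton_iff_locally_determined:
  "cellular_automaton S f \<longleftrightarrow> (\<forall>x \<in> configs S. f x \<in> configs S) \<and>
     (\<forall>i. locally_determined S (\<lambda>x. f x i)) \<and> (\<forall>x \<in> configs S. f (shift x) = shift (f x))"
proof -
  have "continuous_map (full_shift S) (full_shift S) f \<longleftrightarrow>
      (\<forall>i. continuous_map (full_shift S) (discrete_topology S) (\<lambda>x. f x i))"
    by (subst (2) full_shift_def) (simp add: continuous_map_componentwise_UNIV)
  then show ?thesis
    by (auto simp: cellular_automaton_def continuous_map_full_shift_discrete configs_iff)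
qed

text \<open>
  Only finitely many coordinates of \<open>h x\<close> matter to \<open>g\<close>, and each of them is determined by
  finitely many coordinates of \<open>x\<close>.
\<close>
lemma locally_determined_family:
  assumes g: "locally_determined S g" and h: "\<And>k. locally_determined S (\<lambda>x. h x k)"
    and hS: "\<And>x. x \<in> configs S \<Longrightarrow> h x \<in> configs S"
  shows "locally_determined S (\<lambda>x. g (h x))"
  unfolding locally_determined_def
proof
  fix x assume x: "x \<in> configs S"
  obtain K where K: "finite K"
      "\<forall>v \<in> configs S. (\<forall>k \<in> K. v k = h x k) \<longrightarrow> g v = g (h x)"
    using locally_determinedE[OF g hS[OF x]] .
  have "\<forall>k. \<exists>L. finite L \<and> (\<forall>y \<in> configs S. (\<forall>i \<in> L. y i = x i) \<longrightarrow> h y k = h x k)"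
    using h x unfolding locally_determined_def by blast
  then obtain L where L: "\<And>k. finite (L k)"
      "\<And>k y. y \<in> configs S \<Longrightarrow> (\<forall>i \<in> L k. y i = x i) \<Longrightarrow> h y k = h x k"
    by metis
  show "\<exists>K. finite K \<and> (\<forall>y \<in> configs S. (\<forall>i \<in> K. y i = x i) \<longrightarrow> g (h y) = g (h x))"
  proof (intro exI conjI ballI impI)
    show "finite (\<Union>k \<in> K. L k)" using K(1) L(1) by blast
    fix y assume y: "y \<in> configs S" "\<forall>i \<in> \<Union>k \<in> K. L k. y i = x i"
    show "g (h y) = g (h x)"
    proof (rule bspec[OF K(2) hS[OF y(1)], rule_format])
      show "h y k = h x k" if "k \<in> K" for k using y that by (intro L(2)) auto
    qed
  qed
qed

lemma cellular_automaton_translate: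
  assumes f: "cellular_automaton S f" and "x \<in> configs S"
  shows "f (\<lambda>k. x (k + m)) = (\<lambda>k. f x (k + m))"
proof -
  have sh: "f (shift y) = shift (f y)" if "y \<in> configs S" for y
    using f that by (simp add: cellular_automaton_def)
  have X: "(\<lambda>k. x (k + m)) \<in> configs S" for m using assms(2) by (simp add: configs_iff)
  have s: "shift (\<lambda>k. y (k + m)) = (\<lambda>k. y (k + (m + 1)))" for y :: "int \<Rightarrow> 'a" and m
    by (simp add: shift_def algebra_simps)
  show ?thesis
  proof (induction m rule: int_induct[where k = 0])
    case (step1 i)
    then show ?case using sh[OF X[of i]] by (simp only: s)
  next
    case (step2 i)
    have "shift (f (\<lambda>k. x (k + (i - 1)))) = shift (\<lambda>k. f x (k + (i - 1)))"
      using sh[OF X[of "i - 1"]] step2(2) by (simp add: s)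
    then have "f (\<lambda>k. x (k + (i - 1))) (j + 1) = f x (j + 1 + (i - 1))" for j
      unfolding shift_def by meson
    from this[of "j - 1" for j] show ?case by (simp add: fun_eq_iff)
  qed simp
qed

section \<open>Integer iterates of a permutation\<close>

text \<open>
  The argument \<open>q\<close> is meant to be the inverse of \<open>p\<close>; passing it explicitly keeps the iterates
  computable from local rules for \<open>p\<close> and \<open>q\<close>.
\<close>
definition zpow :: "('a \<Rightarrow> 'a) \<Rightarrow> ('a \<Rightarrow> 'a) \<Rightarrow> int \<Rightarrow> 'a \<Rightarrow> 'a" where
  "zpow p q k = (if 0 \<le> k then p ^^ nat k else q ^^ nat (- k))"

lemma zpow_0 [simp]: "zpow p q 0 c = c"
  by (simp add: zpow_def)

lemma zpow_succ:
  assumes "\<And>c. p (q c) = c"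
  shows "zpow p q (k + 1) c = p (zpow p q k c)"
proof (cases "0 \<le> k")
  case True
  then show ?thesis by (simp add: zpow_def nat_add_distrib)
next
  case False
  then have "nat (- k) = Suc (nat (- (k + 1)))" by simp
  then show ?thesis using False assms by (auto simp: zpow_def)
qed

lemma zpow_pred:
  assumes "\<And>c. p (q c) = c" "\<And>c. q (p c) = c"
  shows "zpow p q (k - 1) c = q (zpow p q k c)"
  using zpow_succ[of p q "k - 1" c, OF assms(1)] assms(2) by simp

lemma zpow_add:
  assumes "\<And>c. p (q c) = c" "\<And>c. q (p c) = c"
  shows "zpow p q (k + m) c = zpow p q k (zpow p q m c)"
proof (induction k rule: int_induct[where k = 0])
  case (step1 i)
  have "i + 1 + m = (i + m) + 1" by simp
  then show ?case using step1 zpow_succ[of p q, OF assms(1)] by metis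
next
  case (step2 i)
  have "i - 1 + m = (i + m) - 1" by simp
  then show ?case using step2 zpow_pred[of p q, OF assms] by metis
qed simp

lemma zpow_closed:
  assumes "c \<in> A" "\<And>d. d \<in> A \<Longrightarrow> p d \<in> A" "\<And>d. d \<in> A \<Longrightarrow> q d \<in> A"
  shows "zpow p q k c \<in> A"
proof -
  have "(p ^^ n) c \<in> A" "(q ^^ n) c \<in> A" for n by (induction n) (use assms in auto)
  then show ?thesis by (simp add: zpow_def)
qed

lemma zpow_cong:
  assumes "c \<in> A" "\<And>d. d \<in> A \<Longrightarrow> p d \<in> A" "\<And>d. d \<in> A \<Longrightarrow> q d \<in> A"
    "\<And>d. d \<in> A \<Longrightarrow> p' d = p d" "\<And>d. d \<in> A \<Longrightarrow> q' d = q d"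
  shows "zpow p' q' k c = zpow p q k c"
proof -
  have "(p ^^ n) c \<in> A \<and> (p' ^^ n) c = (p ^^ n) c" "(q ^^ n) c \<in> A \<and> (q' ^^ n) c = (q ^^ n) c" for n
    by (induction n) (use assms in auto)
  then show ?thesis by (simp add: zpow_def)
qed

lemma zpow_conjugate:
  assumes "\<And>d. p' (h d) = h (p d)" "\<And>d. q' (h d) = h (q d)"
  shows "zpow p' q' k (h c) = h (zpow p q k c)"
proof -
  have "(p' ^^ n) (h c) = h ((p ^^ n) c)" "(q' ^^ n) (h c) = h ((q ^^ n) c)" for n
    by (induction n) (use assms in auto)
  then show ?thesis by (simp add: zpow_def)
qed

lemma locally_determined_zpow:
  assumes "\<And>c. locally_determined S (\<lambda>x. p x c)" "\<And>c. locally_determined S (\<lambda>x. q x c)"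
  shows "locally_determined S (\<lambda>x. zpow (p x) (q x) k c)"
proof -
  have "locally_determined S (\<lambda>x. (p x ^^ n) c)" "locally_determined S (\<lambda>x. (q x ^^ n) c)" for n
    by (induction n)
       (simp_all add: locally_determined_const locally_determined_app[where h = p, OF assms(1)]
          locally_determined_app[where h = q, OF assms(2)])
  then show ?thesis by (cases "0 \<le> k") (simp_all add: zpow_def)
qed

section \<open>Short periodic points that are moved\<close>

text \<open>
  The periods are even because a belt of \<open>n\<close> blocks has \<open>2n\<close> cells. Position \<open>n - 1\<close> is the one that
  is placed on top of the last block of a belt. Minimality of \<open>n\<close> is the last conjunct: it
  makes \<open>f\<close> inert on every shorter belt.
\<close>
definition moves_at_length :: "'s set \<Rightarrow> ((int \<Rightarrow> 's) \<Rightarrow> (int \<Rightarrow> 's)) \<Rightarrow> int \<Rightarrow> (int \<Rightarrow> 's) \<Rightarrow> bool" where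
  "moves_at_length S f n u \<longleftrightarrow> n \<ge> 1 \<and> u \<in> configs S \<and> (\<forall>k. u (k + 2 * n) = u k) \<and>
     f u (n - 1) \<noteq> u (n - 1) \<and>
     (\<forall>m v. 1 \<le> m \<longrightarrow> m < n \<longrightarrow> v \<in> configs S \<longrightarrow> (\<forall>k. v (k + 2 * m) = v k) \<longrightarrow> f v = v)"

text \<open>
  Periodic points are dense, so a nontrivial \<open>f\<close> moves one of them: repeat a window of a moved point
  which is large enough to determine the image symbol at the origin. Then take the least possible
  period and translate.
\<close>
lemma moves_at_length_exists:
  assumes f: "cellular_automaton S f" and x: "x \<in> configs S" "f x \<noteq> x"
  obtains n u where "moves_at_length S f n u"
proof -
  define P where "P n \<longleftrightarrow> 1 \<le> n \<and> (\<exists>v \<in> configs S. (\<forall>k. v (k + 2 * int n) = v k) \<and> f v \<noteq> v)" for n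
  obtain j where j: "f x j \<noteq> x j" using x(2) by blast
  define y where "y = (\<lambda>k. x (k + j))"
  have y: "y \<in> configs S" using x(1) by (simp add: y_def configs_iff)
  have fy: "f y 0 \<noteq> y 0" unfolding y_def cellular_automaton_translate[OF f x(1)] using j by simp
  have "locally_determined S (\<lambda>x. f x 0)"
    using f by (simp add: cellular_automaton_iff_locally_determined)
  then obtain K where K: "finite K" "\<forall>v \<in> configs S. (\<forall>i \<in> K. v i = y i) \<longrightarrow> f v 0 = f y 0"
    by (rule locally_determinedE[OF _ y])
  define N where "N = (\<Sum>i\<in>K. \<bar>i\<bar>) + 1"
  have N: "\<bar>i\<bar> < N" if "i \<in> K" for i
    using member_le_sum[of i K abs] that K(1) by (simp add: N_def)
  have N1: "1 \<le> N" by (simp add: N_def sum_nonneg)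
  \<comment> \<open>the window from \<open>- N\<close> to \<open>N - 1\<close> of \<open>y\<close>, repeated\<close>
  define v where "v = (\<lambda>k. y ((k + N) mod (2 * N) - N))"
  have v: "v \<in> configs S" using y by (simp add: v_def configs_iff)
  have eq: "v k = y k" if "\<bar>k\<bar> < N" for k using that by (simp add: v_def)
  have "f v 0 = f y 0" using K(2) v eq N by blast
  then have "f v \<noteq> v" using fy eq[of 0] N1 by auto
  moreover have "v (k + 2 * N) = v k" for k
  proof -
    have "k + 2 * N + N = (k + N) + 2 * N" by simp
    then show ?thesis unfolding v_def by (simp only: mod_add_self2)
  qed
  ultimately have "P (nat N)" using v N1 by (auto simp: P_def)
  define n where "n = (LEAST n. P n)"
  have "P n" unfolding n_def using \<open>P (nat N)\<close> by (rule LeastI)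
  have least: "\<not> P m" if "m < n" for m using that unfolding n_def by (rule not_less_Least)
  obtain w where w: "w \<in> configs S" "\<And>k. w (k + 2 * int n) = w k" "f w \<noteq> w" and n: "1 \<le> n"
    using \<open>P n\<close> by (auto simp: P_def)
  then obtain i where i: "f w i \<noteq> w i" by blast
  define u where "u = (\<lambda>k. w (k + (i - (int n - 1))))"
  have "moves_at_length S f (int n) u"
    unfolding moves_at_length_def
  proof (intro conjI allI impI)
    show "1 \<le> int n" using n by simp
    show "u \<in> configs S" using w(1) by (simp add: u_def configs_iff)
    show "u (k + 2 * int n) = u k" for k
      using w(2)[of "k + (i - (int n - 1))"] by (simp add: u_def algebra_simps)
    show "f u (int n - 1) \<noteq> u (int n - 1)"
      unfolding u_def cellular_automaton_translate[OF f w(1)] using i by simp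
    fix m :: int and v assume m: "1 \<le> m" "m < int n" and v: "v \<in> configs S" "\<forall>k. v (k + 2 * m) = v k"
    have "\<not> P (nat m)" using m by (intro least) simp
    then show "f v = v" using m v by (auto simp: P_def)
  qed
  then show thesis by (rule that)
qed

section \<open>Blocks and conveyor belts\<close>

locale marked_alphabet =
  fixes S :: "'s set" and a b :: 's
  assumes a_in: "a \<in> S" and b_in: "b \<in> S" and a_neq_b: "a \<noteq> b"
begin

text \<open>
  A block starts with \<open>a a\<close> and has \<open>b\<close> at the even offsets from 2 to 10, so that \<open>a a\<close> cannot occur
  again before its end. The odd offsets 3, 5, 7, 9 are free: they hold the kind, the reference
  symbol, the top symbol and the bottom symbol.
\<close>
definition block :: "(int \<Rightarrow> 's) \<Rightarrow> int \<Rightarrow> bool" where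
  "block x p \<longleftrightarrow> x p = a \<and> x (p + 1) = a \<and> x (p + 2) = b \<and> x (p + 4) = b \<and> x (p + 6) = b \<and>
     x (p + 8) = b \<and> x (p + 10) = b"

definition kind :: "(int \<Rightarrow> 's) \<Rightarrow> int \<Rightarrow> bool" where
  "kind x p \<longleftrightarrow> x (p + 3) = a"

text \<open>
  The positions \<open>p - 4\<close> and \<open>p + 5\<close> are the top cell of the block at \<open>p - 11\<close> and the reference symbol of
  the block at \<open>p\<close>.
\<close>
definition live :: "bool \<Rightarrow> (int \<Rightarrow> 's) \<Rightarrow> int \<Rightarrow> bool" where
  "live \<tau> x p \<longleftrightarrow> block x p \<and> kind x p = \<tau> \<and>
     \<not> (block x (p - 11) \<and> kind x (p - 11) \<noteq> \<tau> \<and> x (p - 4) = x (p + 5))"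

definition cell :: "bool \<Rightarrow> (int \<Rightarrow> 's) \<Rightarrow> int \<Rightarrow> bool" where
  "cell \<tau> x i \<longleftrightarrow> live \<tau> x (i - 7) \<or> live \<tau> x (i - 9)"

text \<open>
  One step along a belt is a product of two local involutions: \<open>flip\<close> exchanges the top and bottom cells
  of a live block, and \<open>link\<close> exchanges the bottom cell of a live block with the top cell of the
  next one, if that is live too. From a top cell, the product leads to the top cell on the right,
  from a bottom cell to the bottom cell on the left, and at the ends of a run it turns round.
\<close>
definition flip :: "bool \<Rightarrow> (int \<Rightarrow> 's) \<Rightarrow> int \<Rightarrow> int" where
  "flip \<tau> x i = (if live \<tau> x (i - 7) then i + 2 else if live \<tau> x (i - 9) then i - 2 else i)"

definition link :: "bool \<Rightarrow> (int \<Rightarrow> 's) \<Rightarrow> int \<Rightarrow> int" where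
  "link \<tau> x i = (if live \<tau> x (i - 9) \<and> live \<tau> x (i + 2) then i + 9
     else if live \<tau> x (i - 7) \<and> live \<tau> x (i - 18) then i - 9 else i)"

definition travel :: "bool \<Rightarrow> (int \<Rightarrow> 's) \<Rightarrow> int \<Rightarrow> int \<Rightarrow> int" where
  "travel \<tau> x = zpow (\<lambda>i. link \<tau> x (flip \<tau> x i)) (\<lambda>i. flip \<tau> x (link \<tau> x i))"

text \<open>
  Each cell sees the configuration spelled by its belt with itself at the origin and takes the symbol
  that \<open>f\<close> writes there.
\<close>
definition belt_map :: "bool \<Rightarrow> ((int \<Rightarrow> 's) \<Rightarrow> (int \<Rightarrow> 's)) \<Rightarrow> (int \<Rightarrow> 's) \<Rightarrow> int \<Rightarrow> 's" where
  "belt_map \<tau> f x i = (if cell \<tau> x i then f (\<lambda>k. x (travel \<tau> x k i)) 0 else x i)"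

text \<open>
  A second block starting inside a block would need \<open>a\<close> at two consecutive offsets,
  one of which is even and carries \<open>b\<close>.
\<close>
lemma block_unique:
  assumes "block x p" "block x q" "\<bar>p - q\<bar> \<le> 10"
  shows "p = q"
proof -
  have *: "d = 0" if r: "block x r" "block x (r + d)" "0 \<le> d" "d \<le> 10" for r d
  proof (rule ccontr)
    assume "d \<noteq> 0"
    then have "d \<in> {2, 4, 6, 8, 10} \<or> d + 1 \<in> {2, 4, 6, 8, 10}" using r(3,4) by auto presburger
    moreover have "x (r + k) = b" if "k \<in> {2, 4, 6, 8, 10}" for k
      using r(1) that unfolding block_def by blast
    moreover have "x (r + d) = a" "x (r + (d + 1)) = a"
      using r(2) unfolding block_def by (simp_all add: add.assoc)
    ultimately show False using a_neq_b by metis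
  qed
  show ?thesis
  proof (cases "p \<le> q")
    case True
    then show ?thesis using *[of p "q - p"] assms by simp
  next
    case False
    then show ?thesis using *[of q "p - q"] assms by simp
  qed
qed

lemma live_block: "live \<tau> x p \<Longrightarrow> block x p"
  by (simp add: live_def)

lemma live_unique: "live \<tau> x p \<Longrightarrow> live \<tau> x q \<Longrightarrow> \<bar>p - q\<bar> \<le> 10 \<Longrightarrow> p = q"
  using block_unique[of x p q] live_block by blast

lemma flip_top: "live \<tau> x p \<Longrightarrow> flip \<tau> x (p + 7) = p + 9"
  by (simp add: flip_def)

lemma flip_bottom:
  assumes "live \<tau> x p"
  shows "flip \<tau> x (p + 9) = p + 7"
proof -
  have "\<not> live \<tau> x (p + 2)" using live_unique[of \<tau> x p "p + 2"] assms by auto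
  then show ?thesis using assms by (simp add: flip_def add.commute)
qed

lemma flip_other: "\<not> cell \<tau> x i \<Longrightarrow> flip \<tau> x i = i"
  by (simp add: flip_def cell_def)

lemma link_bottom:
  assumes "live \<tau> x p"
  shows "link \<tau> x (p + 9) = (if live \<tau> x (p + 11) then p + 18 else p + 9)"
proof -
  have "\<not> live \<tau> x (p + 2)" using live_unique[of \<tau> x p "p + 2"] assms by auto
  then show ?thesis using assms by (simp add: link_def add.commute)
qed

lemma link_top:
  assumes "live \<tau> x p"
  shows "link \<tau> x (p + 7) = (if live \<tau> x (p - 11) then p - 2 else p + 7)"
proof -
  have "\<not> live \<tau> x (p - 2)" using live_unique[of \<tau> x p "p - 2"] assms by auto
  then show ?thesis using assms by (simp add: link_def)
qed

lemma link_other: "\<not> cell \<tau> x i \<Longrightarrow> link \<tau> x i = i"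
  by (simp add: link_def cell_def)

lemma cell_cases:
  obtains (top) p where "i = p + 7" "live \<tau> x p" | (bottom) p where "i = p + 9" "live \<tau> x p"
    | (other) "\<not> cell \<tau> x i"
proof -
  consider "live \<tau> x (i - 7)" | "live \<tau> x (i - 9)" | "\<not> cell \<tau> x i"
    unfolding cell_def by blast
  then show thesis
    by cases (use top[of "i - 7"] bottom[of "i - 9"] other in auto)
qed

lemma cell_top: "live \<tau> x p \<Longrightarrow> cell \<tau> x (p + 7)"
  by (simp add: cell_def)

lemma cell_bottom: "live \<tau> x p \<Longrightarrow> cell \<tau> x (p + 9)"
  by (simp add: cell_def)

lemma flip_flip: "flip \<tau> x (flip \<tau> x i) = i"
  by (cases i \<tau> x rule: cell_cases) (simp_all add: flip_top flip_bottom flip_other)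

lemma link_link: "link \<tau> x (link \<tau> x i) = i"
proof (cases i \<tau> x rule: cell_cases)
  case (top p)
  then show ?thesis using link_bottom[of \<tau> x "p - 11"] by (simp add: link_top)
next
  case (bottom p)
  then show ?thesis using link_top[of \<tau> x "p + 11"] by (simp add: link_bottom add.commute)
qed (simp add: link_other)

lemma cell_flip: "cell \<tau> x (flip \<tau> x i) \<longleftrightarrow> cell \<tau> x i"
  by (cases i \<tau> x rule: cell_cases)
     (simp_all add: flip_top flip_bottom flip_other cell_top cell_bottom)

lemma cell_link: "cell \<tau> x (link \<tau> x i) \<longleftrightarrow> cell \<tau> x i"
proof (cases i \<tau> x rule: cell_cases)
  case (top p)
  then show ?thesis using cell_bottom[of \<tau> x "p - 11"] by (simp add: link_top cell_top)
next
  case (bottom p)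
  then show ?thesis using cell_top[of \<tau> x "p + 11"] by (simp add: link_bottom cell_bottom add.commute)
qed (simp add: link_other)

lemma travel_0 [simp]: "travel \<tau> x 0 i = i"
  by (simp add: travel_def)

lemma travel_add: "travel \<tau> x (k + m) i = travel \<tau> x k (travel \<tau> x m i)"
  unfolding travel_def by (rule zpow_add) (simp_all add: flip_flip link_link)

lemma travel_1: "travel \<tau> x 1 i = link \<tau> x (flip \<tau> x i)"
  by (simp add: travel_def zpow_def)

lemma cell_travel: "cell \<tau> x i \<Longrightarrow> cell \<tau> x (travel \<tau> x k i)"
  unfolding travel_def
  using zpow_closed[of i "Collect (cell \<tau> x)"] by (simp add: cell_flip cell_link)

lemma travel_cong:
  assumes "live \<tau> y = live \<tau> x"
  shows "travel \<tau> y = travel \<tau> x"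
proof -
  have "flip \<tau> y = flip \<tau> x" "link \<tau> y = link \<tau> x"
    by (rule ext, simp add: flip_def link_def assms)+
  then show ?thesis by (simp add: travel_def)
qed

text \<open>
  Another cell of the belt sees a translate of the same configuration, and \<open>f\<close> commutes with
  translations. Hence after the map the belt spells the image under \<open>f\<close> of what it spelled before.
\<close>
lemma belt_map_travel:
  assumes f: "cellular_automaton S f" and x: "x \<in> configs S" and i: "cell \<tau> x i"
  shows "belt_map \<tau> f x (travel \<tau> x m i) = f (\<lambda>k. x (travel \<tau> x k i)) m"
proof -
  have u: "(\<lambda>k. x (travel \<tau> x k i)) \<in> configs S" using x by (simp add: configs_iff)
  have "belt_map \<tau> f x (travel \<tau> x m i) = f (\<lambda>k. x (travel \<tau> x (k + m) i)) 0"
    using cell_travel[OF i, of m] by (simp only: belt_map_def travel_add if_True)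
  also have "\<dots> = f (\<lambda>k. x (travel \<tau> x k i)) (0 + m)"
    by (rule fun_cong[OF cellular_automaton_translate[OF f u]])
  finally show ?thesis by simp
qed

lemma belt_map_in_configs:
  assumes "cellular_automaton S f" "x \<in> configs S"
  shows "belt_map \<tau> f x \<in> configs S"
proof -
  have "f (\<lambda>k. x (travel \<tau> x k i)) \<in> configs S" for i
    by (rule cellular_automaton_in_full_shift[OF assms(1)]) (use assms(2) in \<open>simp add: configs_iff\<close>)
  then show ?thesis using assms(2) by (simp add: belt_map_def configs_iff)
qed

lemma block_data_offset:
  assumes "block x p" "block x q" "p + s = q + 7 \<or> p + s = q + 9" "0 \<le> s" "s \<le> 10"
  shows "p = q" "s = 7 \<or> s = 9"
proof -
  show "p = q" using assms by (intro block_unique[of x]) auto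
  then show "s = 7 \<or> s = 9" using assms(3) by auto
qed

text \<open>
  Rewriting data cells neither destroys a block nor creates one: a block has no fixed letter
  in a data cell of another block, both before and after the change.
\<close>
lemma block_cong:
  assumes "\<And>i. y i \<noteq> x i \<Longrightarrow> \<exists>p. block x p \<and> (i = p + 7 \<or> i = p + 9)"
  shows "block y = block x"
proof -
  let ?s = "{0, 1, 2, 4, 6, 8, 10 :: int}"
  have keep: "y (p + s) = x (p + s)" if "block x p" "s \<in> ?s" for p s
  proof (rule ccontr)
    assume "y (p + s) \<noteq> x (p + s)"
    then obtain q where "block x q" "p + s = q + 7 \<or> p + s = q + 9" using assms by blast
    moreover have "0 \<le> s" "s \<le> 10" using that(2) by auto
    ultimately have "s = 7 \<or> s = 9" using block_data_offset(2)[OF that(1)] by blast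
    then show False using that(2) by auto
  qed
  have up: "block y p" if "block x p" for p
  proof -
    have "y p = x p" "y (p + 1) = x (p + 1)" "y (p + 2) = x (p + 2)" "y (p + 4) = x (p + 4)"
      "y (p + 6) = x (p + 6)" "y (p + 8) = x (p + 8)" "y (p + 10) = x (p + 10)"
      using keep[OF that, of 0] by (simp_all add: keep[OF that])
    then show ?thesis using that by (simp only: block_def)
  qed
  have keep': "y (p + s) = x (p + s)" if "block y p" "s \<in> ?s" for p s
  proof (rule ccontr)
    assume "y (p + s) \<noteq> x (p + s)"
    then obtain q where q: "block x q" "p + s = q + 7 \<or> p + s = q + 9" using assms by blast
    moreover have "0 \<le> s" "s \<le> 10" using that(2) by auto
    ultimately have "s = 7 \<or> s = 9" using block_data_offset(2)[OF that(1) up[OF q(1)]] by blast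
    then show False using that(2) by auto
  qed
  have down: "block x p" if "block y p" for p
  proof -
    have "y p = x p" "y (p + 1) = x (p + 1)" "y (p + 2) = x (p + 2)" "y (p + 4) = x (p + 4)"
      "y (p + 6) = x (p + 6)" "y (p + 8) = x (p + 8)" "y (p + 10) = x (p + 10)"
      using keep'[OF that, of 0] by (simp_all add: keep'[OF that])
    then show ?thesis using that by (simp only: block_def)
  qed
  show ?thesis using up down by blast
qed

lemma belt_map_changes:
  assumes "belt_map \<tau> f x i \<noteq> x i"
  obtains p where "live \<tau> x p" "i = p + 7 \<or> i = p + 9"
  using assms by (cases i \<tau> x rule: cell_cases) (auto simp: belt_map_def)

lemma block_belt_map [simp]: "block (belt_map \<tau> f x) = block x"
  by (rule block_cong) (meson belt_map_changes live_block)

lemma belt_map_static: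
  assumes "block x p" "0 \<le> s" "s \<le> 10" "(s \<noteq> 7 \<and> s \<noteq> 9) \<or> \<not> live \<tau> x p"
  shows "belt_map \<tau> f x (p + s) = x (p + s)"
proof (rule ccontr)
  assume "belt_map \<tau> f x (p + s) \<noteq> x (p + s)"
  then obtain q where "live \<tau> x q" "p + s = q + 7 \<or> p + s = q + 9" by (rule belt_map_changes)
  then show False
    using block_data_offset[OF assms(1) live_block, of \<tau> q s] assms by blast
qed

lemma kind_belt_map [simp]: "block x p \<Longrightarrow> kind (belt_map \<tau> f x) p \<longleftrightarrow> kind x p"
  using belt_map_static[of x p 3] by (simp add: kind_def)

text \<open>
  Liveness for kind \<open>\<tau>\<close> depends on fixed letters, kinds, reference symbols, and data of
  blocks of the other kind, none of which the map touches. So the belts stay the same.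
\<close>
lemma live_belt_map [simp]: "live \<tau> (belt_map \<tau> f x) = live \<tau> x"
proof
  fix p
  have "belt_map \<tau> f x (p + 5) = x (p + 5)" if "block x p"
    using belt_map_static[OF that, of 5] by simp
  moreover have "belt_map \<tau> f x (p - 4) = x (p - 4)" if "block x (p - 11)" "kind x (p - 11) \<noteq> \<tau>"
  proof -
    have "\<not> live \<tau> x (p - 11)" using that(2) by (simp add: live_def)
    then show ?thesis using belt_map_static[OF that(1), of 7 \<tau>] by simp
  qed
  ultimately show "live \<tau> (belt_map \<tau> f x) p = live \<tau> x p"
    by (cases "block x p"; cases "block x (p - 11) \<and> kind x (p - 11) \<noteq> \<tau>")
       (simp_all add: live_def)
qed

lemma cell_belt_map [simp]: "cell \<tau> (belt_map \<tau> f x) = cell \<tau> x"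
  by (simp add: cell_def fun_eq_iff)

lemma belt_map_comp:
  assumes g: "cellular_automaton S g" and x: "x \<in> configs S"
    and h: "\<And>u. u \<in> configs S \<Longrightarrow> h u = f (g u)"
  shows "belt_map \<tau> f (belt_map \<tau> g x) = belt_map \<tau> h x"
proof
  fix i
  have u: "(\<lambda>k. x (travel \<tau> x k i)) \<in> configs S" using x by (simp add: configs_iff)
  have "belt_map \<tau> f (belt_map \<tau> g x) i =
      f (\<lambda>k. belt_map \<tau> g x (travel \<tau> x k i)) 0" if "cell \<tau> x i"
    using that by (subst belt_map_def) (simp add: travel_cong[OF live_belt_map])
  then show "belt_map \<tau> f (belt_map \<tau> g x) i = belt_map \<tau> h x i"
    using belt_map_travel[OF g x] h[OF u]
    by (cases "cell \<tau> x i") (simp_all add: belt_map_def)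
qed

lemma belt_map_id:
  assumes "x \<in> configs S" "\<And>u. u \<in> configs S \<Longrightarrow> f u = u"
  shows "belt_map \<tau> f x = x"
proof
  fix i
  have "(\<lambda>k. x (travel \<tau> x k i)) \<in> configs S" using assms(1) by (simp add: configs_iff)
  then show "belt_map \<tau> f x i = x i" using assms(2) by (simp add: belt_map_def)
qed

lemma live_shift: "live \<tau> (shift x) p = live \<tau> x (p + 1)"
  by (simp add: live_def block_def kind_def shift_def algebra_simps)

lemma cell_shift: "cell \<tau> (shift x) i = cell \<tau> x (i + 1)"
  by (simp add: cell_def live_shift algebra_simps)

lemma travel_shift: "travel \<tau> x k (i + 1) = travel \<tau> (shift x) k i + 1"
proof -
  have f: "flip \<tau> x (d + 1) = flip \<tau> (shift x) d + 1" for d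
    by (simp add: flip_def live_shift algebra_simps)
  have l: "link \<tau> x (d + 1) = link \<tau> (shift x) d + 1" for d
    by (simp add: link_def live_shift algebra_simps)
  show ?thesis unfolding travel_def by (rule zpow_conjugate) (simp_all only: f l)
qed

lemma belt_map_shift: "belt_map \<tau> f (shift x) = shift (belt_map \<tau> f x)"
proof
  fix i
  show "belt_map \<tau> f (shift x) i = shift (belt_map \<tau> f x) i"
    unfolding belt_map_def shift_def[of "\<lambda>i. if cell \<tau> x i then _ i else _ i"] 
    by (simp only: cell_shift travel_shift) (simp add: shift_def)
qed

lemma locally_determined_live: "locally_determined S (\<lambda>x. live \<tau> x p)"
proof -
  have c: "locally_determined S (\<lambda>x. x i = c)" for i c
    by (rule locally_determined_comp[OF locally_determined_coord])
  have e: "locally_determined S (\<lambda>x. x i = x j)" for i j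
    by (rule locally_determined_comp2[OF locally_determined_coord locally_determined_coord])
  have conj: "locally_determined S (\<lambda>x. P x \<and> Q x)"
    if "locally_determined S P" "locally_determined S Q" for P Q
    by (rule locally_determined_comp2[OF that])
  have blk: "locally_determined S (\<lambda>x. block x p)" for p
    unfolding block_def by (intro conj c)
  have k: "locally_determined S (\<lambda>x. kind x p = \<tau>)" for p \<tau>
    unfolding kind_def by (rule locally_determined_comp[OF c])
  show ?thesis unfolding live_def
    by (intro conj blk k locally_determined_comp[where g = Not] e) 
qed

lemma locally_determined_travel: "locally_determined S (\<lambda>x. travel \<tau> x k i)"
proof -
  have conj: "locally_determined S (\<lambda>x. live \<tau> x i \<and> live \<tau> x j)" for i j
    by (rule locally_determined_comp2[OF locally_determined_live locally_determined_live])
  have f: "locally_determined S (\<lambda>x. flip \<tau> x d)" for d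
    unfolding flip_def by (intro locally_determined_if locally_determined_live locally_determined_const)
  have l: "locally_determined S (\<lambda>x. link \<tau> x d)" for d
    unfolding link_def by (intro locally_determined_if conj locally_determined_const)
  show ?thesis unfolding travel_def
    by (intro locally_determined_zpow)
       (rule locally_determined_app[where h = "link \<tau>", OF l f]
          locally_determined_app[where h = "flip \<tau>", OF f l])+
qed

lemma cellular_automaton_belt_map:
  assumes f: "cellular_automaton S f"
  shows "cellular_automaton S (belt_map \<tau> f)"
proof -
  have cell: "locally_determined S (\<lambda>x. cell \<tau> x i)" for i
    unfolding cell_def
    by (rule locally_determined_comp2[OF locally_determined_live locally_determined_live])
  have f0: "locally_determined S (\<lambda>u. f u 0)"
    using f by (simp add: cellular_automaton_iff_locally_determined)
  have "locally_determined S (\<lambda>x. f (\<lambda>k. x (travel \<tau> x k i)) 0)" for i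
  proof (rule locally_determined_family[OF f0])
    show "locally_determined S (\<lambda>x. x (travel \<tau> x k i))" for k
      by (rule locally_determined_app[where h = "\<lambda>x. x", OF locally_determined_coord
            locally_determined_travel])
  qed (simp add: configs_iff)
  then have ld: "locally_determined S (\<lambda>x. belt_map \<tau> f x i)" for i
    unfolding belt_map_def
    by (intro locally_determined_if cell locally_determined_coord)
  show ?thesis unfolding cellular_automaton_iff_locally_determined
  proof (intro conjI ballI allI)
    show "belt_map \<tau> f x \<in> configs S" if "x \<in> configs S" for x
      using f that by (rule belt_map_in_configs)
    show "locally_determined S (\<lambda>x. belt_map \<tau> f x i)" for i by (rule ld)
    show "belt_map \<tau> f (shift x) = shift (belt_map \<tau> f x)" for x by (rule belt_map_shift)
  qed
qed

section \<open>The two actions of the automorphism group\<close>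

definition belt_aut :: "bool \<Rightarrow> ((int \<Rightarrow> 's) \<Rightarrow> (int \<Rightarrow> 's)) \<Rightarrow> (int \<Rightarrow> 's) \<Rightarrow> int \<Rightarrow> 's" where
  "belt_aut \<tau> f = restrict (belt_map \<tau> f) (configs S)"

lemma belt_aut_hom: "belt_aut \<tau> \<in> hom (Aut_shift S) (Aut_shift S)"
proof (rule homI)
  fix f assume "f \<in> carrier (Aut_shift S)"
  then obtain g where f: "cellular_automaton S f" and g: "cellular_automaton S g"
    and fg: "\<And>x. x \<in> configs S \<Longrightarrow> g (f x) = x" "\<And>x. x \<in> configs S \<Longrightarrow> f (g x) = x"
    by (auto simp: Aut_shift_def)
  have inv: "belt_map \<tau> g (belt_map \<tau> f x) = x" "belt_map \<tau> f (belt_map \<tau> g x) = x"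
    if "x \<in> configs S" for x
    using belt_map_comp[OF f that, of "\<lambda>u. u" g] belt_map_comp[OF g that, of "\<lambda>u. u" f] fg
      belt_map_id[OF that, of "\<lambda>u. u"] by simp_all
  have "cellular_automaton S (belt_aut \<tau> f)"
    by (rule cellular_automaton_cong[OF cellular_automaton_belt_map[OF f]])
       (simp add: belt_aut_def)
  then show "belt_aut \<tau> f \<in> carrier (Aut_shift S)"
    using cellular_automaton_belt_map[OF g] belt_map_in_configs[OF g] inv
    by (auto simp: Aut_shift_def belt_aut_def intro!: exI[of _ "belt_map \<tau> g"])
next
  fix f g assume "f \<in> carrier (Aut_shift S)" "g \<in> carrier (Aut_shift S)"
  then have g: "cellular_automaton S g" by (auto simp: Aut_shift_def)
  show "belt_aut \<tau> (f \<otimes>\<^bsub>Aut_shift S\<^esub> g) = belt_aut \<tau> f \<otimes>\<^bsub>Aut_shift S\<^esub> belt_aut \<tau> g"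
  proof
    fix x
    show "belt_aut \<tau> (f \<otimes>\<^bsub>Aut_shift S\<^esub> g) x = (belt_aut \<tau> f \<otimes>\<^bsub>Aut_shift S\<^esub> belt_aut \<tau> g) x"
    proof (cases "x \<in> configs S")
      case True
      then have "belt_map \<tau> f (belt_map \<tau> g x) = belt_map \<tau> (compose (configs S) f g) x"
        by (rule belt_map_comp[OF g]) (simp add: compose_def)
      then show ?thesis
        using True belt_map_in_configs[OF g True] by (simp add: Aut_shift_def belt_aut_def compose_def)
    qed (simp add: Aut_shift_def belt_aut_def compose_def)
  qed
qed

section \<open>Finite belts\<close>

text \<open>
  The position of the \<open>m\<close>-th cell of the belt consisting of \<open>n\<close> blocks, numbered from \<open>A\<close>, of a configuration
  with blocks at all multiples of 11.
\<close>
definition track :: "int \<Rightarrow> int \<Rightarrow> int \<Rightarrow> int" where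
  "track A n m = (let r = m mod (2 * n) in
     if r < n then 11 * (A + r) + 7 else 11 * (A + (2 * n - 1 - r)) + 9)"

lemma track_periodic: "track A n (m + 2 * n) = track A n m"
  by (simp add: track_def)

lemma track_top: "0 \<le> r \<Longrightarrow> r < n \<Longrightarrow> track A n r = 11 * (A + r) + 7"
  by (simp add: track_def)

lemma track_cases:
  assumes "n \<ge> 1"
  obtains c where "A \<le> c" "c < A + n" "track A n m = 11 * c + 7 \<or> track A n m = 11 * c + 9"
proof (cases "m mod (2 * n) < n")
  case True
  moreover have "0 \<le> m mod (2 * n)" using assms by simp
  ultimately show ?thesis using that[of "A + m mod (2 * n)"] by (simp add: track_def Let_def)
next
  case False
  moreover have "m mod (2 * n) < 2 * n" using assms by simp
  ultimately show ?thesis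
    using that[of "A + (2 * n - 1 - m mod (2 * n))"] by (simp add: track_def Let_def)
qed

lemma link_flip_track:
  assumes n: "n \<ge> 1" and live: "\<And>c. A \<le> c \<Longrightarrow> c < A + n \<Longrightarrow> live \<tau> x (11 * c)"
    and ends: "\<not> live \<tau> x (11 * (A - 1))" "\<not> live \<tau> x (11 * (A + n))"
  shows "link \<tau> x (flip \<tau> x (track A n m)) = track A n (m + 1)"
proof -
  define r where "r = m mod (2 * n)"
  have r: "0 \<le> r" "r < 2 * n" using n by (auto simp: r_def)
  have r': "(m + 1) mod (2 * n) = (if r = 2 * n - 1 then 0 else r + 1)"
  proof -
    have "(m + 1) mod (2 * n) = (r + 1) mod (2 * n)" unfolding r_def by (simp add: mod_add_left_eq)
    then show ?thesis using r by auto
  qed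
  show ?thesis
  proof (cases "r < n")
    case True
    then have l: "live \<tau> x (11 * (A + r))" using r by (intro live) auto
    have next_live: "live \<tau> x (11 * (A + r) + 11) \<longleftrightarrow> r + 1 < n"
    proof (cases "r + 1 < n")
      case True
      then show ?thesis using live[of "A + r + 1"] r by (simp add: algebra_simps)
    next
      case False
      then have e: "11 * (A + n) = 11 * (A + r) + 11" using \<open>r < n\<close> by simp
      show ?thesis using False ends(2) unfolding e by blast
    qed
    have "track A n m = 11 * (A + r) + 7" using True by (simp add: track_def r_def[symmetric])
    moreover have "track A n (m + 1) =
        (if r + 1 < n then 11 * (A + r) + 18 else 11 * (A + r) + 9)"
      using True r r' by (auto simp: track_def Let_def algebra_simps)
    ultimately show ?thesis by (simp only: flip_top[OF l] link_bottom[OF l] next_live)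
  next
    case False
    define c where "c = A + (2 * n - 1 - r)"
    have l: "live \<tau> x (11 * c)" unfolding c_def using r False by (intro live) auto
    have prev_live: "live \<tau> x (11 * c - 11) \<longleftrightarrow> r \<noteq> 2 * n - 1"
    proof (cases "r = 2 * n - 1")
      case True
      then have "c = A" by (simp add: c_def)
      then show ?thesis using True ends(1) by (simp add: algebra_simps)
    next
      case r_less: False
      then have "live \<tau> x (11 * (c - 1))" unfolding c_def using r False by (intro live) auto
      then show ?thesis using r_less by (simp add: algebra_simps)
    qed
    have "track A n m = 11 * c + 9" using False by (simp add: track_def r_def[symmetric] c_def)
    moreover have "track A n (m + 1) = (if r \<noteq> 2 * n - 1 then 11 * c - 2 else 11 * c + 7)"
      using False r n r' by (auto simp: track_def Let_def c_def algebra_simps)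
    ultimately show ?thesis by (simp only: flip_bottom[OF l] link_top[OF l] prev_live)
  qed
qed

lemma travel_inj: "travel \<tau> x k i = travel \<tau> x k j \<Longrightarrow> i = j"
  using travel_add[of \<tau> x "- k" k i] travel_add[of \<tau> x "- k" k j] by simp

text \<open>
  On a maximal finite run of live blocks, walking along the belt is counting modulo \<open>2 * n\<close>.
\<close>
lemma belt_map_track:
  assumes f: "cellular_automaton S f" and x: "x \<in> configs S" and n: "n \<ge> 1"
    and live: "\<And>c. A \<le> c \<Longrightarrow> c < A + n \<Longrightarrow> live \<tau> x (11 * c)"
    and ends: "\<not> live \<tau> x (11 * (A - 1))" "\<not> live \<tau> x (11 * (A + n))"
  shows "belt_map \<tau> f x (track A n m) = f (\<lambda>k. x (track A n k)) m"
proof -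
  have step: "travel \<tau> x 1 (track A n m) = track A n (m + 1)" for m
    unfolding travel_1 by (rule link_flip_track) (use assms in auto)
  have tr: "travel \<tau> x k (track A n 0) = track A n k" for k
  proof (induction k rule: int_induct[where k = 0])
    case (step1 k)
    have "travel \<tau> x (1 + k) (track A n 0) = track A n (k + 1)"
      unfolding travel_add step1(2) by (rule step)
    then show ?case by (simp add: add.commute)
  next
    case (step2 k)
    have "travel \<tau> x 1 (travel \<tau> x (k - 1) (track A n 0)) = travel \<tau> x (1 + (k - 1)) (track A n 0)"
      by (rule travel_add[symmetric])
    also have "\<dots> = travel \<tau> x 1 (track A n (k - 1))"
      using step2(2) step[of "k - 1"] by simp
    finally show ?case by (rule travel_inj)
  qed simp
  have "track A n 0 = 11 * A + 7" using track_top[of 0 n A] n by simp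
  then have "cell \<tau> x (track A n 0)" using cell_top live[of A] n by simp
  from belt_map_travel[OF f x this, of m] show ?thesis by (simp only: tr)
qed

section \<open>Locality at a change of kind\<close>

definition tiled :: "(int \<Rightarrow> 's) \<Rightarrow> bool" where
  "tiled x \<longleftrightarrow> (\<forall>c. block x (11 * c))"

lemma tiled_belt_map [simp]: "tiled (belt_map \<tau> f x) = tiled x"
  by (simp add: tiled_def)

lemma tiled_live:
  assumes "tiled x" "live \<tau> x p"
  obtains c where "p = 11 * c"
proof -
  have "block x (11 * (p div 11))" using assms(1) by (simp add: tiled_def)
  moreover have "\<bar>p - 11 * (p div 11)\<bar> \<le> 10"
    by (simp add: minus_mult_div_eq_mod)
  ultimately have "p = 11 * (p div 11)" using live_block[OF assms(2)] block_unique by blast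
  then show ?thesis by (rule that)
qed

lemma live_tiled:
  "tiled x \<Longrightarrow> live \<tau> x (11 * c) \<longleftrightarrow> kind x (11 * c) = \<tau> \<and>
     (kind x (11 * (c - 1)) = \<tau> \<or> x (11 * c - 4) \<noteq> x (11 * c + 5))"
proof -
  assume "tiled x"
  then have "block x (11 * c)" "block x (11 * (c - 1))" unfolding tiled_def by blast+
  then show ?thesis by (auto simp: live_def algebra_simps)
qed

lemma belt_map_cong_on:
  assumes eq: "\<And>i. i \<in> A \<Longrightarrow> y i = x i"
    and closed: "\<And>i. i \<in> A \<Longrightarrow> flip \<tau> x i \<in> A" "\<And>i. i \<in> A \<Longrightarrow> link \<tau> x i \<in> A"
    and same: "\<And>i. i \<in> A \<Longrightarrow> flip \<tau> y i = flip \<tau> x i" "\<And>i. i \<in> A \<Longrightarrow> link \<tau> y i = link \<tau> x i"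
      "\<And>i. i \<in> A \<Longrightarrow> cell \<tau> y i \<longleftrightarrow> cell \<tau> x i"
    and i: "i \<in> A"
  shows "belt_map \<tau> f y i = belt_map \<tau> f x i"
proof -
  have "travel \<tau> y k i = travel \<tau> x k i" for k
    unfolding travel_def by (rule zpow_cong[where A = A]) (simp_all add: i closed same)
  moreover have "travel \<tau> x k i \<in> A" for k
    unfolding travel_def by (rule zpow_closed) (simp_all add: i closed)
  ultimately show ?thesis using same(3)[OF i] eq i by (simp add: belt_map_def)
qed

text \<open>
  No belt crosses a boundary between blocks of different kinds, and liveness of a block depends on
  its left neighbour only. So the part to the left of such a boundary evolves on its own.
\<close>
lemma belt_map_local_left:
  assumes x: "tiled x" and y: "tiled y" and eq: "\<And>i. i < 11 * B \<Longrightarrow> y i = x i"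
    and change: "kind x (11 * B) \<noteq> kind x (11 * (B - 1))" "kind y (11 * B) \<noteq> kind y (11 * (B - 1))"
    and i: "i < 11 * B"
  shows "belt_map \<tau> f y i = belt_map \<tau> f x i"
proof -
  have live: "live \<tau> y p \<longleftrightarrow> live \<tau> x p" if "p < 11 * B" for p
  proof -
    have "live \<tau> y (11 * c) \<longleftrightarrow> live \<tau> x (11 * c)" if "c < B" for c
      using that by (simp add: live_tiled x y kind_def eq)
    then show ?thesis using that x y by (metis mult_less_cancel_left_pos tiled_live zero_less_numeral)
  qed
  have cut: False
    if z: "tiled z" "kind z (11 * B) \<noteq> kind z (11 * (B - 1))"
      and p: "live \<tau> z p" "live \<tau> z q" "q = p + 11" "p < 11 * B" "11 * B \<le> q" for z p q
  proof -
    obtain c where c: "p = 11 * c" using tiled_live[OF z(1) p(1)] by blast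
    then have e: "11 * (B - 1) = p" "11 * B = q" using p by auto
    have "live \<tau> z (11 * (B - 1))" "live \<tau> z (11 * B)" using p by (simp_all only: e)
    then show False using z by (simp add: live_def)
  qed
  have top: "live \<tau> x p \<Longrightarrow> p < 11 * B \<Longrightarrow> p + 10 < 11 * B" for p
    by (auto elim!: tiled_live[OF x])
  show ?thesis
  proof (rule belt_map_cong_on[where A = "{..<11 * B}"])
    fix i assume "i \<in> {..<11 * B}"
    then have i: "i < 11 * B" by simp
    show "y i = x i" using i by (rule eq)
    show "flip \<tau> x i \<in> {..<11 * B}" using i top[of "i - 7"] by (auto simp: flip_def)
    have "i + 9 < 11 * B" if "live \<tau> x (i - 9)" "live \<tau> x (i + 2)"
      using cut[OF x change(1) that] top[OF that(2)] i by force
    then show "link \<tau> x i \<in> {..<11 * B}" using i by (simp add: link_def)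
    show "flip \<tau> y i = flip \<tau> x i" "cell \<tau> y i \<longleftrightarrow> cell \<tau> x i"
      using i by (simp_all add: flip_def cell_def live)
    have "live \<tau> y (i - 9) \<and> live \<tau> y (i + 2) \<longleftrightarrow> live \<tau> x (i - 9) \<and> live \<tau> x (i + 2)"
    proof (cases "i + 2 < 11 * B")
      case True
      then show ?thesis using i live[of "i - 9"] live[of "i + 2"] by simp
    next
      case False
      then have q: "i - 9 < 11 * B" "11 * B \<le> i + 2" "i + 2 = i - 9 + 11" using i by simp_all
      show ?thesis
        using cut[OF x change(1) _ _ q(3,1,2)] cut[OF y change(2) _ _ q(3,1,2)] by blast
    qed
    then show "link \<tau> y i = link \<tau> x i" using i by (simp only: link_def live)
  qed (use i in simp)
qed

text \<open>
  Of the blocks on the right only the first looks across the boundary to decide whether it is live, and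
  it is not of kind \<open>\<tau>\<close>.
\<close>
lemma belt_map_local_right:
  assumes x: "tiled x" and y: "tiled y" and eq: "\<And>i. 11 * B \<le> i \<Longrightarrow> y i = x i"
    and other: "kind x (11 * B) \<noteq> \<tau>" and i: "11 * B \<le> i"
  shows "belt_map \<tau> f y i = belt_map \<tau> f x i"
proof -
  have live: "live \<tau> y p \<longleftrightarrow> live \<tau> x p" if "11 * B - 11 < p" for p
  proof -
    have "live \<tau> y (11 * c) \<longleftrightarrow> live \<tau> x (11 * c)" if "B \<le> c" for c
    proof (cases "c = B")
      case True
      then show ?thesis using other by (simp add: live_def kind_def eq)
    next
      case False
      then show ?thesis using that by (simp add: live_tiled x y kind_def eq)
    qed
    moreover have "B \<le> c" if "p = 11 * c" for c using that \<open>11 * B - 11 < p\<close> by simp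
    ultimately show ?thesis using x y by (metis tiled_live)
  qed
  have "\<not> live \<tau> x (11 * B)" using other by (simp add: live_def)
  then have above: "11 * B + 11 \<le> p" if "live \<tau> x p" "11 * B - 11 < p" for p
  proof -
    obtain c where c: "p = 11 * c" using tiled_live[OF x \<open>live \<tau> x p\<close>] by blast
    then have "B \<le> c" "c \<noteq> B" using that other by (auto simp: live_def)
    then show ?thesis using c by simp
  qed
  show ?thesis
  proof (rule belt_map_cong_on[where A = "{11 * B..}"])
    fix i assume "i \<in> {11 * B..}"
    then have i: "11 * B \<le> i" by simp
    show "y i = x i" using i by (rule eq)
    show "flip \<tau> x i \<in> {11 * B..}" using i above[of "i - 9"] by (auto simp: flip_def)
    show "link \<tau> x i \<in> {11 * B..}" using i above[of "i - 7"] by (auto simp: link_def)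
    show "flip \<tau> y i = flip \<tau> x i" "cell \<tau> y i \<longleftrightarrow> cell \<tau> x i"
      using i by (simp_all add: flip_def cell_def live)
    have "live \<tau> y (i - 7) \<and> live \<tau> y (i - 18) \<longleftrightarrow> live \<tau> x (i - 7) \<and> live \<tau> x (i - 18)"
      using i above[of "i - 7"] live[of "i - 7"] live[of "i - 18"] by auto
    then show "link \<tau> y i = link \<tau> x i" using i by (simp only: link_def live)
  qed (use i in simp)
qed

section \<open>Relays\<close>

definition layout :: "(int \<Rightarrow> bool) \<Rightarrow> (int \<Rightarrow> 's) \<Rightarrow> (int \<Rightarrow> 's) \<Rightarrow> (int \<Rightarrow> 's) \<Rightarrow> int \<Rightarrow> 's" where
  "layout K R D E i = (let q = i div 11; r = i mod 11 in
     if r = 0 \<or> r = 1 then a else if r = 3 then (if K q then a else b)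
     else if r = 5 then R q else if r = 7 then D q else if r = 9 then E q else b)"

lemma layout_at: "0 \<le> r \<Longrightarrow> r < 11 \<Longrightarrow> layout K R D E (11 * q + r) =
    (if r = 0 \<or> r = 1 then a else if r = 3 then (if K q then a else b)
     else if r = 5 then R q else if r = 7 then D q else if r = 9 then E q else b)"
  by (simp add: layout_def Let_def)

lemma layout_in_configs:
  "(\<And>q. R q \<in> S) \<Longrightarrow> (\<And>q. D q \<in> S) \<Longrightarrow> (\<And>q. E q \<in> S) \<Longrightarrow> layout K R D E \<in> configs S"
  using a_in b_in by (auto simp: configs_iff layout_def Let_def)

lemma block_layout: "block (layout K R D E) (11 * q)"
  using layout_at[of 0 K R D E q] by (simp add: block_def layout_at)

lemma kind_layout: "kind (layout K R D E) (11 * q) = K q"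
  using a_neq_b by (simp add: kind_def layout_at)

definition run :: "(bool \<times> ((int \<Rightarrow> 's) \<Rightarrow> (int \<Rightarrow> 's))) list \<Rightarrow> (int \<Rightarrow> 's) \<Rightarrow> (int \<Rightarrow> 's)" where
  "run ls x = foldr (\<lambda>(\<tau>, f). belt_map \<tau> f) ls x"

lemma run_Nil [simp]: "run [] x = x"
  by (simp add: run_def)

lemma run_Cons [simp]: "run ((\<tau>, f) # ls) x = belt_map \<tau> f (run ls x)"
  by (simp add: run_def)

lemma tiled_run [simp]: "tiled (run ls x) = tiled x"
  by (induction ls) auto

lemma run_in_configs:
  "\<forall>(\<tau>, f) \<in> set ls. cellular_automaton S f \<Longrightarrow> x \<in> configs S \<Longrightarrow> run ls x \<in> configs S"
  by (induction ls) (auto simp: belt_map_in_configs)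

text \<open>
  The head of the list is the factor that is applied last. In \<open>relay ls x B\<close> the blocks numbered from
  0 to \<open>B - 1\<close> are divided into one segment for each factor, in the order of application. Each segment
  is of the kind of its factor \<open>f\<close> and bounded by blocks of the other kind; at the time when \<open>f\<close> is applied it
  holds a shortest point moved by \<open>f\<close>, and its first block is dead because its reference symbol is the
  top symbol on its left at that time.
\<close>
inductive relay :: "(bool \<times> ((int \<Rightarrow> 's) \<Rightarrow> (int \<Rightarrow> 's))) list \<Rightarrow> (int \<Rightarrow> 's) \<Rightarrow> int \<Rightarrow> bool" where
  relay_Nil: "tiled x \<Longrightarrow> x \<in> configs S \<Longrightarrow> relay [] x 0"
| relay_Cons: "relay ls x B \<Longrightarrow> moves_at_length S f n u \<Longrightarrow>
    kind (run ls x) (11 * (B - 1)) \<noteq> \<tau> \<Longrightarrow>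
    (\<And>c. B \<le> c \<Longrightarrow> c < B + n \<Longrightarrow> kind (run ls x) (11 * c) = \<tau>) \<Longrightarrow>
    kind (run ls x) (11 * (B + n)) \<noteq> \<tau> \<Longrightarrow>
    run ls x (11 * B + 5) = run ls x (11 * B - 4) \<Longrightarrow>
    (\<And>m. run ls x (track B n m) = u m) \<Longrightarrow>
    relay ((\<tau>, f) # ls) x (B + n)"

lemma relay_tiled: "relay ls x B \<Longrightarrow> tiled x"
  by (induction rule: relay.induct)

lemma relay_in_configs: "relay ls x B \<Longrightarrow> x \<in> configs S"
  by (induction rule: relay.induct)

lemma relay_nonneg: "relay ls x B \<Longrightarrow> 0 \<le> B \<and> (ls \<noteq> [] \<longrightarrow> 1 \<le> B)"
  by (induction rule: relay.induct) (auto simp: moves_at_length_def)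

lemma kind_belt_map_tiled: "tiled x \<Longrightarrow> kind (belt_map \<tau> f x) (11 * c) = kind x (11 * c)"
  by (simp add: tiled_def)

text \<open>
  The blocks to the right of the segments in the final configuration may be replaced by others, as
  long as the kind still changes there. Undoing the factors one at a time, locality on the left ensures
  that all intermediate configurations agree with the old ones on the segments.
\<close>
lemma relay_pull_back:
  assumes "relay ls x B" "\<forall>(\<tau>, f) \<in> set ls. f \<in> carrier (Aut_shift S)"
    "tiled y" "y \<in> configs S" "\<And>i. i < 11 * B \<Longrightarrow> y i = run ls x i"
    "ls \<noteq> [] \<Longrightarrow> kind y (11 * B) \<noteq> kind y (11 * (B - 1))"
  shows "\<exists>x'. run ls x' = y \<and> relay ls x' B"
  using assms
proof (induction arbitrary: y rule: relay.induct)
  case (relay_Nil x)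
  then show ?case using relay.relay_Nil by auto
next
  case (relay_Cons ls x B f n u \<tau> y)
  let ?z = "run ls x"
  have n: "1 \<le> n" using relay_Cons.hyps(2) by (simp add: moves_at_length_def)
  from relay_Cons.prems(1) obtain g where f: "cellular_automaton S f" and g: "cellular_automaton S g"
    and fg: "\<And>x. x \<in> configs S \<Longrightarrow> g (f x) = x" "\<And>x. x \<in> configs S \<Longrightarrow> f (g x) = x"
    by (auto simp: Aut_shift_def)
  have aut: "\<forall>(\<tau>, f) \<in> set ls. f \<in> carrier (Aut_shift S)" using relay_Cons.prems(1) by simp
  then have ca: "\<forall>(\<tau>, f) \<in> set ls. cellular_automaton S f" by (auto simp: Aut_shift_def)
  have z: "tiled ?z" "?z \<in> configs S"
    using relay_tiled relay_in_configs relay_Cons.hyps(1) run_in_configs[OF ca] by auto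
  define y' where "y' = belt_map \<tau> g y"
  have y': "tiled y'" "y' \<in> configs S"
    using relay_Cons.prems(2,3) g by (simp_all add: y'_def belt_map_in_configs)
  have "belt_map \<tau> g (belt_map \<tau> f ?z) = ?z"
    using belt_map_comp[OF f z(2), of "\<lambda>u. u" g] fg(1) belt_map_id[OF z(2)] by simp
  moreover have "belt_map \<tau> g y i = belt_map \<tau> g (belt_map \<tau> f ?z) i" if "i < 11 * (B + n)" for i
  proof (rule belt_map_local_left[OF _ relay_Cons.prems(2) _ _ _ that])
    show "tiled (belt_map \<tau> f ?z)" using z by simp
    show "y i = belt_map \<tau> f ?z i" if "i < 11 * (B + n)" for i
      using relay_Cons.prems(4)[OF that] by simp
    show "kind (belt_map \<tau> f ?z) (11 * (B + n)) \<noteq> kind (belt_map \<tau> f ?z) (11 * (B + n - 1))"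
      unfolding kind_belt_map_tiled[OF z(1)]
      using relay_Cons.hyps(4)[of "B + n - 1"] relay_Cons.hyps(5) n by linarith
    show "kind y (11 * (B + n)) \<noteq> kind y (11 * (B + n - 1))" using relay_Cons.prems(5) by simp
  qed
  ultimately have eq: "y' i = ?z i" if "i < 11 * (B + n)" for i using that by (simp add: y'_def)
  have keq: "kind y' (11 * c) = kind ?z (11 * c)" if "c < B + n" for c
    using that by (simp add: kind_def eq)
  have end_kind: "kind y' (11 * (B + n)) \<noteq> \<tau>"
  proof -
    have "kind y (11 * (B + n - 1)) = kind y' (11 * (B + n - 1))"
      unfolding y'_def by (rule kind_belt_map_tiled[symmetric, OF relay_Cons.prems(2)])
    also have "\<dots> = \<tau>" using relay_Cons.hyps(4)[of "B + n - 1"] keq[of "B + n - 1"] n by simp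
    finally show ?thesis
      using relay_Cons.prems(5) unfolding y'_def kind_belt_map_tiled[OF relay_Cons.prems(2)] by simp
  qed
  have "\<exists>x'. run ls x' = y' \<and> relay ls x' B"
  proof (rule relay_Cons.IH[OF aut y'])
    show "y' i = run ls x i" if "i < 11 * B" for i using that n by (intro eq) simp
    show "kind y' (11 * B) \<noteq> kind y' (11 * (B - 1))"
      using relay_Cons.hyps(3) relay_Cons.hyps(4)[of B] keq[of B] keq[of "B - 1"] n by simp
  qed
  then obtain x' where x': "run ls x' = y'" "relay ls x' B" by blast
  have "belt_map \<tau> f y' = y"
    using belt_map_comp[OF g relay_Cons.prems(3), of "\<lambda>u. u" f] fg(2)
      belt_map_id[OF relay_Cons.prems(3)] by (simp add: y'_def)
  then have "run ((\<tau>, f) # ls) x' = y" by (simp add: x'(1))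
  moreover have "relay ((\<tau>, f) # ls) x' (B + n)"
  proof (rule relay.relay_Cons[OF x'(2) relay_Cons.hyps(2)], unfold x'(1))
    show "kind y' (11 * (B - 1)) \<noteq> \<tau>" using relay_Cons.hyps(3) keq[of "B - 1"] n by simp
    show "kind y' (11 * c) = \<tau>" if "B \<le> c" "c < B + n" for c
      using relay_Cons.hyps(4)[OF that] that by (simp add: keq)
    show "kind y' (11 * (B + n)) \<noteq> \<tau>" by (rule end_kind)
    show "y' (11 * B + 5) = y' (11 * B - 4)" using relay_Cons.hyps(6) n by (simp add: eq)
    show "y' (track B n m) = u m" for m
    proof -
      have "track B n m < 11 * (B + n)" by (rule track_cases[OF n, of B m]) auto
      then show ?thesis using relay_Cons.hyps(7) by (simp add: eq)
    qed
  qed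
  ultimately show ?case by (intro exI[of _ x'] conjI)
qed

text \<open>
  A segment for a new last factor is written to the right of the configuration that the
  previous factors produce, where the symbol to be copied into the reference cell is known, and
  then pulled back. The kind \<open>\<tau>\<close> is the kind of a factor that may follow.
\<close>
lemma relay_exists:
  assumes "successively (\<lambda>s t. fst s \<noteq> fst t) ls"
    "\<forall>(\<tau>, f) \<in> set ls. f \<in> carrier (Aut_shift S) \<and> f \<noteq> \<one>\<^bsub>Aut_shift S\<^esub>"
    "ls = [] \<or> fst (hd ls) \<noteq> \<tau>"
  shows "\<exists>x B. relay ls x B \<and> kind (run ls x) (11 * (B - 1)) \<noteq> \<tau>"
  using assms
proof (induction ls arbitrary: \<tau>)
  case Nil
  let ?x = "layout (\<lambda>_. \<not> \<tau>) (\<lambda>_. a) (\<lambda>_. a) (\<lambda>_. a)"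
  have "relay [] ?x 0"
    using a_in by (intro relay_Nil layout_in_configs) (simp_all add: tiled_def block_layout)
  moreover have "kind ?x (11 * (0 - 1)) \<noteq> \<tau>" by (simp only: kind_layout) simp
  ultimately show ?case by (metis run_Nil)
next
  case (Cons l ls \<tau>)
  obtain \<rho> f where l: "l = (\<rho>, f)" by force
  have \<rho>: "\<rho> \<noteq> \<tau>" using Cons.prems(3) l by simp
  have aut: "\<forall>(\<tau>, f) \<in> set ls. f \<in> carrier (Aut_shift S)" using Cons.prems(2) by auto
  then have ca: "\<forall>(\<tau>, f) \<in> set ls. cellular_automaton S f" by (auto simp: Aut_shift_def)
  obtain x B where x: "relay ls x B" "kind (run ls x) (11 * (B - 1)) \<noteq> \<rho>"
    using Cons.IH[of \<rho>] Cons.prems l by (auto simp: successively_Cons)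
  define z where "z = run ls x"
  have z: "tiled z" "z \<in> configs S"
    using relay_tiled relay_in_configs x(1) run_in_configs[OF ca] by (auto simp: z_def)
  have f: "cellular_automaton S f" "f \<in> extensional (configs S)" "f \<noteq> \<one>\<^bsub>Aut_shift S\<^esub>"
    using Cons.prems(2) l by (auto simp: Aut_shift_def)
  have "\<exists>v \<in> configs S. f v \<noteq> v"
  proof (rule ccontr)
    assume "\<not> ?thesis"
    then have "f = \<one>\<^bsub>Aut_shift S\<^esub>"
      using f(2) by (intro extensionalityI[of _ "configs S"]) (auto simp: Aut_shift_def)
    then show False using f(3) by simp
  qed
  then obtain n u where nu: "moves_at_length S f n u" using moves_at_length_exists[OF f(1)] by metis
  then have n: "1 \<le> n" and u: "\<And>k. u k \<in> S" and per: "\<And>k. u (k + 2 * n) = u k"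
    by (auto simp: moves_at_length_def configs_iff)
  \<comment> \<open>the new segment has kind \<open>\<rho>\<close> and everything after it the other kind; bottom symbols
    are read from right to left\<close>
  define e where "e = layout (\<lambda>q. (q < B + n) = \<rho>) (\<lambda>_. z (11 * B - 4))
    (\<lambda>q. u (q - B)) (\<lambda>q. u (2 * n - 1 - (q - B)))"
  define y where "y = (\<lambda>i. if i < 11 * B then z i else e i)"
  have e_in: "e \<in> configs S" unfolding e_def using u z(2) by (intro layout_in_configs) (auto simp: configs_iff)
  have y_left: "y i = z i" if "i < 11 * B" for i using that by (simp add: y_def)
  have y_right: "y i = e i" if "11 * B \<le> i" for i using that by (simp add: y_def)
  have y_in: "y \<in> configs S" using e_in z(2) by (simp add: y_def configs_iff)
  have y_tiled: "tiled y" unfolding tiled_def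
  proof
    fix c
    show "block y (11 * c)"
    proof (cases "c < B")
      case True
      then have "block z (11 * c)" using z(1) by (simp add: tiled_def)
      then show ?thesis using True by (simp add: block_def y_left)
    next
      case False
      have "block e (11 * c)" unfolding e_def by (rule block_layout)
      then show ?thesis using False by (simp add: block_def y_right)
    qed
  qed
  have kind_left: "kind y (11 * c) = kind z (11 * c)" if "c < B" for c
    using that by (simp add: kind_def y_left)
  have kind_right: "kind y (11 * c) \<longleftrightarrow> (c < B + n) = \<rho>" if "B \<le> c" for c
  proof -
    have "kind y (11 * c) = kind e (11 * c)" using that by (simp add: kind_def y_right)
    then show ?thesis by (simp add: e_def kind_layout)
  qed
  have "\<exists>x'. run ls x' = y \<and> relay ls x' B"
  proof (rule relay_pull_back[OF x(1) aut y_tiled y_in])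
    show "y i = run ls x i" if "i < 11 * B" for i using that by (simp add: y_left z_def)
    show "kind y (11 * B) \<noteq> kind y (11 * (B - 1))"
      using x(2) n kind_left[of "B - 1"] kind_right[of B] by (auto simp: z_def)
  qed
  then obtain x' where x': "run ls x' = y" "relay ls x' B" by blast
  have "relay ((\<rho>, f) # ls) x' (B + n)"
  proof (rule relay_Cons[OF x'(2) nu], unfold x'(1))
    show "kind y (11 * (B - 1)) \<noteq> \<rho>" using x(2) kind_left[of "B - 1"] by (simp add: z_def)
    show "kind y (11 * c) = \<rho>" if "B \<le> c" "c < B + n" for c using that kind_right by auto
    show "kind y (11 * (B + n)) \<noteq> \<rho>" using n kind_right[of "B + n"] by auto
    show "y (11 * B + 5) = y (11 * B - 4)" by (simp add: y_right y_left e_def layout_at)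
    show "y (track B n m) = u m" for m
    proof -
      have mod: "u m = u (m mod (2 * n))"
      proof -
        have "u (k + 2 * n * j) = u k" for j k
        proof (induction j rule: int_induct[where k = 0])
          case (step1 j)
          then show ?case using per[of "k + 2 * n * j"] by (simp add: algebra_simps)
        next
          case (step2 j)
          then show ?case using per[of "k + 2 * n * (j - 1)"] by (simp add: algebra_simps)
        qed simp
        from this[of "m mod (2 * n)" "m div (2 * n)"] show ?thesis by simp
      qed
      have r: "0 \<le> m mod (2 * n)" "m mod (2 * n) < 2 * n" using n by simp_all
      have "track B n m \<ge> 11 * B" by (rule track_cases[OF n, of B m]) auto
      then have "y (track B n m) = e (track B n m)" by (rule y_right)
      also have "\<dots> = u (m mod (2 * n))"
      proof (cases "m mod (2 * n) < n")
        case True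
        have "e (11 * (B + m mod (2 * n)) + 7) = u (m mod (2 * n))"
          unfolding e_def by (subst layout_at) simp_all
        then show ?thesis using True by (simp only: track_def Let_def if_True)
      next
        case False
        have "e (11 * (B + (2 * n - 1 - m mod (2 * n))) + 9) = u (m mod (2 * n))"
          unfolding e_def by (subst layout_at) simp_all
        then show ?thesis using False by (simp only: track_def Let_def if_False)
      qed
      finally show ?thesis using mod by simp
    qed
  qed
  moreover have "kind (run ((\<rho>, f) # ls) x') (11 * (B + n - 1)) \<noteq> \<tau>"
    unfolding run_Cons x'(1) kind_belt_map_tiled[OF y_tiled]
    using \<rho> n kind_right[of "B + n - 1"] by simp
  ultimately show ?case unfolding l by (intro exI[of _ x'] exI[of _ "B + n"] conjI)
qed

text \<open>
  The position \<open>11 * B - 4\<close> is the top cell of the block numbered \<open>B - 1\<close>, the last of the relay (or the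
  block before it, for an empty list). In \<open>x\<close> the first block of every segment is dead when its factor is
  applied, so the segment keeps its contents. In \<open>x'\<close> the symbol to the left of the segment
  differs from the reference symbol, so the first block is live and the factor changes the top symbol
  at the right end. To the right of the segment the two configurations still agree, so the next
  segment is in the required state in both.
\<close>
lemma relay_transmits:
  assumes "relay ls x B" "\<forall>(\<tau>, f) \<in> set ls. cellular_automaton S f"
    "tiled x'" "x' \<in> configs S" "\<And>i. 0 \<le> i \<Longrightarrow> x' i = x i"
    "x' (- 4) \<noteq> x (- 4)" "kind x' (- 11) = kind x (- 11)"
  shows "(\<forall>i \<ge> 11 * B. run ls x' i = run ls x i) \<and> run ls x' (11 * B - 4) \<noteq> run ls x (11 * B - 4) \<and>
    kind (run ls x') (11 * (B - 1)) = kind (run ls x) (11 * (B - 1))"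
  using assms
proof (induction rule: relay.induct)
  case (relay_Nil x)
  then show ?case by simp
next
  case (relay_Cons ls x B f n u \<tau>)
  define y where "y = run ls x"
  define y' where "y' = run ls x'"
  have nu: "moves_at_length S f n u" by fact
  then have n: "1 \<le> n" by (simp add: moves_at_length_def)
  have f: "cellular_automaton S f" and ca: "\<forall>(\<tau>, f) \<in> set ls. cellular_automaton S f"
    using relay_Cons.prems(1) by auto
  have y: "tiled y" "y \<in> configs S"
    using relay_tiled relay_in_configs relay_Cons.hyps(1) run_in_configs[OF ca] by (auto simp: y_def)
  have y': "tiled y'" "y' \<in> configs S"
    using relay_Cons.prems(2,3) run_in_configs[OF ca] by (auto simp: y'_def)
  have IH: "(\<forall>i \<ge> 11 * B. y' i = y i) \<and> y' (11 * B - 4) \<noteq> y (11 * B - 4) \<and>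
      kind y' (11 * (B - 1)) = kind y (11 * (B - 1))"
    unfolding y_def y'_def by (rule relay_Cons.IH[OF ca relay_Cons.prems(2-)])
  then have diff: "y' (11 * B - 4) \<noteq> y (11 * B - 4)"
    and kind: "kind y' (11 * (B - 1)) = kind y (11 * (B - 1))" by blast+
  have eq: "y' i = y i" if "11 * B \<le> i" for i using IH that by blast
  note hyps = relay_Cons.hyps(3-7)[folded y_def]
  have keq: "kind y' (11 * c) = kind y (11 * c)" if "B \<le> c" for c using that by (simp add: kind_def eq)
  have ends: "\<not> live \<tau> y (11 * (B + n))" "\<not> live \<tau> y' (11 * (B + n))" "\<not> live \<tau> y' (11 * (B - 1))"
    unfolding live_def using hyps(1,3) kind keq[of "B + n"] n by simp_all
  \<comment> \<open>In \<open>y\<close> the first block is dead, in \<open>y'\<close> the whole segment is live.\<close>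
  have first: "\<not> live \<tau> y (11 * B)" using hyps(1,4) by (simp add: live_tiled y)
  have live: "live \<tau> y (11 * c)" if "B < c" "c < B + n" for c
    using that hyps(2)[of c] hyps(2)[of "c - 1"] by (simp add: live_tiled y)
  have live': "live \<tau> y' (11 * c)" if "B \<le> c" "c < B + n" for c
  proof (cases "c = B")
    case True
    then show ?thesis using that hyps(2)[of B] hyps(4) diff by (simp add: live_tiled y' keq eq)
  next
    case False
    then show ?thesis
      using that hyps(2)[of c] hyps(2)[of "c - 1"] keq[of c] keq[of "c - 1"] by (simp add: live_tiled y')
  qed
  have out: "track B n (n - 1) = 11 * (B + n) - 4" using track_top[of "n - 1" n B] n by simp
  have tr: "y' (track B n m) = u m" for m
  proof -
    have "11 * B \<le> track B n m" by (rule track_cases[OF n, of B m]) auto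
    then show ?thesis using hyps(5) by (simp add: eq)
  qed
  have "belt_map \<tau> f y' (track B n (n - 1)) = f (\<lambda>k. y' (track B n k)) (n - 1)"
    using live' ends by (intro belt_map_track[OF f y'(2) n]) auto
  then have "belt_map \<tau> f y' (11 * (B + n) - 4) = f u (n - 1)" by (simp only: tr out)
  moreover have "f u (n - 1) \<noteq> u (n - 1)" using nu by (simp add: moves_at_length_def)
  moreover have "y (11 * (B + n) - 4) = u (n - 1)" using hyps(5)[of "n - 1"] by (simp only: out)
  \<comment> \<open>In \<open>y\<close> there remains a belt of \<open>n - 1\<close> blocks, or none at all, and \<open>f\<close> is inert on it.\<close>
  moreover have "belt_map \<tau> f y (11 * (B + n) - 4) = y (11 * (B + n) - 4)"
  proof (cases "n = 1")
    case True
    have "block y (11 * B)" using y(1) by (simp add: tiled_def)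
    then show ?thesis using belt_map_static[of y "11 * B" 7 \<tau> f] first True by (simp add: add.commute)
  next
    case False
    define v where "v = (\<lambda>m. y (track (B + 1) (n - 1) m))"
    have "v \<in> configs S" using y(2) by (simp add: v_def configs_iff)
    moreover have "v (k + 2 * (n - 1)) = v k" for k by (simp only: v_def track_periodic)
    moreover have "1 \<le> n - 1" "n - 1 < n" using n False by auto
    ultimately have fv: "f v = v" using nu unfolding moves_at_length_def by blast
    have out': "track (B + 1) (n - 1) (n - 2) = 11 * (B + n) - 4"
      using track_top[of "n - 2" "n - 1" "B + 1"] n False by simp
    have "belt_map \<tau> f y (track (B + 1) (n - 1) (n - 2)) = f v (n - 2)"
      unfolding v_def
      using live first ends n False by (intro belt_map_track[OF f y(2)]) auto
    also have "\<dots> = y (track (B + 1) (n - 1) (n - 2))" unfolding fv by (simp add: v_def)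
    finally show ?thesis unfolding out' .
  qed
  ultimately have "belt_map \<tau> f y' (11 * (B + n) - 4) \<noteq> belt_map \<tau> f y (11 * (B + n) - 4)" by simp
  moreover have "belt_map \<tau> f y' i = belt_map \<tau> f y i" if "11 * (B + n) \<le> i" for i
    using n by (intro belt_map_local_right[OF y(1) y'(1) _ hyps(3) that] eq) simp
  moreover have "kind (belt_map \<tau> f y') (11 * (B + n - 1)) = kind (belt_map \<tau> f y) (11 * (B + n - 1))"
    unfolding kind_belt_map_tiled[OF y(1)] kind_belt_map_tiled[OF y'(1)] using n by (intro keq) simp
  ultimately show ?case by (simp add: y_def y'_def)
qed

text \<open>
  Change the top symbol of the block just before the relay. If the product were the identity, the
  change could not appear at the right end of the relay.
\<close>
lemma alternating_run_moves:
  assumes "ls \<noteq> []" "successively (\<lambda>s t. fst s \<noteq> fst t) ls"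
    "\<forall>(\<tau>, f) \<in> set ls. f \<in> carrier (Aut_shift S) \<and> f \<noteq> \<one>\<^bsub>Aut_shift S\<^esub>"
  obtains x where "x \<in> configs S" "run ls x \<noteq> x"
proof -
  have ca: "\<forall>(\<tau>, f) \<in> set ls. cellular_automaton S f" using assms(3) by (auto simp: Aut_shift_def)
  obtain x B where x: "relay ls x B"
    using relay_exists[OF assms(2,3), of "\<not> fst (hd ls)"] by auto
  have B: "1 \<le> B" using relay_nonneg[OF x] assms(1) by simp
  define s where "s = (if x (- 4) = a then b else a)"
  define x' where "x' = x(- 4 := s)"
  have s: "s \<in> S" "s \<noteq> x (- 4)" using a_in b_in a_neq_b by (auto simp: s_def)
  have x_in: "x \<in> configs S" using x by (rule relay_in_configs)
  have x'_in: "x' \<in> configs S" using s(1) x_in by (simp add: x'_def configs_iff)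
  have "block x (- 11)" using relay_tiled[OF x] unfolding tiled_def by (metis mult_minus1_right)
  then have "block x' = block x" by (intro block_cong) (auto simp: x'_def split: if_splits)
  then have "tiled x'" using relay_tiled[OF x] by (simp add: tiled_def)
  then have "run ls x' (11 * B - 4) \<noteq> run ls x (11 * B - 4)"
    using relay_transmits[OF x ca _ x'_in] s(2) by (simp add: x'_def kind_def)
  moreover have "x' (11 * B - 4) = x (11 * B - 4)" using B by (simp add: x'_def)
  ultimately have "run ls x' \<noteq> x' \<or> run ls x \<noteq> x" by auto
  then show thesis using that x_in x'_in by blast
qed

end

section \<open>Free products\<close>

theorem theorem2:
  fixes S :: "'s set"
    and G :: "('g, 'x) monoid_scheme" and H :: "('h, 'y) monoid_scheme"
  assumes "finite S" and "card S \<ge> 2"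
    and "group G" and "group H"
    and "embeds G (Aut_shift S)" and "embeds H (Aut_shift S)"
  shows "embeds (free_product G H) (Aut_shift S)"
proof -
  have "\<not> card S \<le> Suc 0" using assms(2) by simp
  then obtain a b where "a \<in> S" "b \<in> S" "a \<noteq> b"
    unfolding card_le_Suc0_iff_eq[OF assms(1)] by blast
  then interpret marked_alphabet S a b by unfold_locales
  interpret two_groups G H using assms(3,4) by (simp add: two_groups_def)
  let ?K = "Aut_shift S"
  interpret K: group ?K by (rule group_Aut_shift)
  interpret P: group P by (rule group_free_product)
  obtain \<phi> where \<phi>: "\<phi> \<in> hom G ?K" "inj_on \<phi> (carrier G)" using assms(5) by (auto simp: embeds_def)
  obtain \<psi> where \<psi>: "\<psi> \<in> hom H ?K" "inj_on \<psi> (carrier H)" using assms(6) by (auto simp: embeds_def)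
  have "belt_aut True \<circ> \<phi> \<in> hom G ?K" "belt_aut False \<circ> \<psi> \<in> hom H ?K"
    using hom_compose[OF \<phi>(1) belt_aut_hom] hom_compose[OF \<psi>(1) belt_aut_hom] by auto
  from free_product_universal(1)[OF K.group_axioms this]
  obtain F where F: "F \<in> hom P ?K"
    "\<And>g. g \<in> carrier G \<Longrightarrow> F (fp_inl G g) = belt_aut True (\<phi> g)"
    "\<And>h. h \<in> carrier H \<Longrightarrow> F (fp_inr H h) = belt_aut False (\<psi> h)" by auto
  have one: "\<phi> \<one>\<^bsub>G\<^esub> = \<one>\<^bsub>?K\<^esub>" "\<psi> \<one>\<^bsub>H\<^esub> = \<one>\<^bsub>?K\<^esub>"
    using hom_one[OF \<phi>(1)] hom_one[OF \<psi>(1)] G.group_axioms H.group_axioms K.group_axioms by auto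
  define letter where "letter = case_sum (\<lambda>g. (True, \<phi> g)) (\<lambda>h. (False, \<psi> h))"
  have letter: "F [s] = belt_aut (fst (letter s)) (snd (letter s)) \<and>
      snd (letter s) \<in> carrier ?K \<and> snd (letter s) \<noteq> \<one>\<^bsub>?K\<^esub>" if "s \<in> letters" for s
  proof (cases s)
    case (Inl g)
    then have g: "g \<in> carrier G" "g \<noteq> \<one>\<^bsub>G\<^esub>" using that by auto
    then have "\<phi> g \<noteq> \<one>\<^bsub>?K\<^esub>" using inj_onD[OF \<phi>(2), of g "\<one>\<^bsub>G\<^esub>"] one(1) by force
    then show ?thesis
      using F(2)[OF g(1)] g hom_in_carrier[OF \<phi>(1) g(1)] by (simp add: Inl letter_def fp_inl_def)
  next
    case (Inr h)
    then have h: "h \<in> carrier H" "h \<noteq> \<one>\<^bsub>H\<^esub>" using that by auto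
    then have "\<psi> h \<noteq> \<one>\<^bsub>?K\<^esub>" using inj_onD[OF \<psi>(2), of h "\<one>\<^bsub>H\<^esub>"] one(2) by force
    then show ?thesis
      using F(3)[OF h(1)] h hom_in_carrier[OF \<psi>(1) h(1)] by (simp add: Inr letter_def fp_inr_def)
  qed
  have F_run: "F w x = run (map letter w) x" if "w \<in> carrier P" "x \<in> configs S" for w x
    using that(1)
  proof (induction w)
    case Nil
    have "F [] = \<one>\<^bsub>?K\<^esub>" using hom_one[OF F(1)] P.group_axioms K.group_axioms by simp
    then show ?case using that(2) by (simp add: Aut_shift_def)
  next
    case (Cons s w)
    have s: "s \<in> letters" "[s] \<in> carrier P" "w \<in> carrier P"
      using Cons.prems by (auto simp: free_product_Cons)
    have "F (s # w) = F [s] \<otimes>\<^bsub>?K\<^esub> F w"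
      using hom_mult[OF F(1) s(2,3)] fp_cons_reduced[OF Cons.prems] by simp
    then have "F (s # w) x = F [s] (F w x)" using that(2) by (simp add: Aut_shift_def compose_def)
    moreover have "F w \<in> carrier ?K" using F(1) s(3) by (rule hom_in_carrier)
    then have "F w x \<in> configs S"
      using that(2) cellular_automaton_in_full_shift by (fastforce simp: Aut_shift_def)
    ultimately have "F (s # w) x = belt_map (fst (letter s)) (snd (letter s)) (F w x)"
      using letter[OF s(1)] by (simp add: belt_aut_def)
    then show ?case
      using Cons.IH[OF s(3)] run_Cons[of "fst (letter s)" "snd (letter s)"] by simp
  qed
  have trivial: "w = []" if w: "w \<in> carrier P" "F w = \<one>\<^bsub>?K\<^esub>" for w
  proof (rule ccontr)
    assume "w \<noteq> []"
    have fst_letter: "fst (letter s) = isl s" for s by (cases s) (simp_all add: letter_def)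
    have "set w \<subseteq> letters" "successively (\<lambda>s t. isl s \<noteq> isl t) w"
      using w(1) by (auto simp: free_product_def)
    then have "successively (\<lambda>s t. fst s \<noteq> fst t) (map letter w)"
      and "\<forall>s \<in> set w. snd (letter s) \<in> carrier ?K \<and> snd (letter s) \<noteq> \<one>\<^bsub>?K\<^esub>"
      using letter by (simp add: successively_map fst_letter, blast)
    then obtain x where x: "x \<in> configs S" "run (map letter w) x \<noteq> x"
      using alternating_run_moves[of "map letter w"] \<open>w \<noteq> []\<close> by (auto simp: split_def)
    then show False using F_run[OF w(1) x(1)] w(2) by (simp add: Aut_shift_def)
  qed
  interpret F: group_hom P ?K F
    using F(1) P.group_axioms K.group_axioms by (simp add: group_hom_def group_hom_axioms_def)
  have "inj_on F (carrier P)"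
    unfolding F.inj_iff_trivial_ker
    using trivial F.hom_one by (auto simp: kernel_def)
  then show ?thesis using F(1) by (auto simp: embeds_def)
qed

end
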